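(* Let $\mathcal{H}$ be a complex Hilbert space of finite dimension $d\ge 2$. Let $\rho_1,\rho_2\in\mathcal{D}(\mathcal{H})$ with $\frac12\|\rho_1-\rho_2\|_1=\varepsilon$ for some $\varepsilon\in[0,1]$. Let $\rho_+,\rho_-\in\mathcal{D}(\mathcal{H})$ with $\rho_+\perp\rho_-$ be the normalized Jordan-Hahn decomposition of $\rho_1-\rho_2$, i.e. $\rho_1-\rho_2=\varepsilon\rho_+-\varepsilon\rho_-$. Then $$S(\rho_1)-S(\rho_2)\le \varepsilon S(\rho_+)-\varepsilon S(\rho_-)+h(\varepsilon).$$ Moreover, the inequality is tight: for every $\varepsilon\in[0,1]$ there exist states $\rho_1,\rho_2\in\mathcal{D}(\mathcal{H})$ with $\frac12\|\rho_1-\rho_2\|_1=\varepsilon$ for which (with the corresponding $\rho_\pm$) equality holds.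
   Context: $\mathcal{D}(\mathcal{H})$ denotes the set of quantum states (density matrices) on $\mathcal{H}$: positive semi-definite operators of unit trace. $\|\cdot\|_1$ is the trace norm. $\log$ is the natural logarithm and $0\log 0=0$. The von Neumann entropy is $S(\rho)=-\mathrm{Tr}(\rho\log\rho)$, and $h(\varepsilon)=-\varepsilon\log\varepsilon-(1-\varepsilon)\log(1-\varepsilon)$ is the binary entropy. $\rho_+\perp\rho_-$ means that the operators have orthogonal supports. The Jordan-Hahn decomposition writes $\rho_1-\rho_2=\Delta_+-\Delta_-$ with $\Delta_\pm\ge 0$ of orthogonal supports; then $\Delta_\pm=\varepsilon\rho_\pm$ if $\varepsilon>0$, and if $\varepsilon=0$ the states $\rho_\pm$ are an arbitrary choice of states with orthogonal supports. *)

theory Defs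
  imports Complex_Main "Jordan_Normal_Form.Schur_Decomposition"
    "Jordan_Normal_Form.Matrix_Kernel"
begin

text \<open>A complex Hilbert space of finite dimension \<open>d\<close> is taken to be \<open>\<complex>\<^sup>d\<close> with its standard
  inner product; operators on it are the elements of \<^term>\<open>carrier_mat d d :: complex mat set\<close>.\<close>

definition mat_trace :: "'a :: comm_monoid_add mat \<Rightarrow> 'a" where
  "mat_trace A = (\<Sum>i<dim_row A. A $$ (i, i))"

definition hermitian_mat :: "complex mat \<Rightarrow> bool" where
  "hermitian_mat A \<longleftrightarrow> mat_adjoint A = A"

definition psd_mat :: "nat \<Rightarrow> complex mat \<Rightarrow> bool" where
  "psd_mat d A \<longleftrightarrow> A \<in> carrier_mat d d \<and> hermitian_mat A \<and>
     (\<forall>v\<in>carrier_vec d. 0 \<le> Re ((A *\<^sub>v v) \<bullet>c v))"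

definition density_mats :: "nat \<Rightarrow> complex mat set" where
  "density_mats d = {\<rho>. psd_mat d \<rho> \<and> mat_trace \<rho> = 1}"

definition unitary_mat :: "nat \<Rightarrow> complex mat \<Rightarrow> bool" where
  "unitary_mat d U \<longleftrightarrow> U \<in> carrier_mat d d \<and>
     mat_adjoint U * U = 1\<^sub>m d \<and> U * mat_adjoint U = 1\<^sub>m d"

definition real_diag :: "nat \<Rightarrow> (nat \<Rightarrow> real) \<Rightarrow> complex mat" where
  "real_diag d l = mat_diag d (\<lambda>i. complex_of_real (l i))"

definition spectral_decomp :: "nat \<Rightarrow> complex mat \<Rightarrow> complex mat \<Rightarrow> (nat \<Rightarrow> real) \<Rightarrow> bool" where
  "spectral_decomp d A U l \<longleftrightarrow> unitary_mat d U \<and> A = U * real_diag d l * mat_adjoint U"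

text \<open>Functional calculus \<open>f(A)\<close> for Hermitian \<open>A\<close>. By the lemma \<open>mat_fun_eq\<close> below, the
  result does not depend on the chosen spectral decomposition.\<close>

definition mat_fun :: "(real \<Rightarrow> real) \<Rightarrow> complex mat \<Rightarrow> complex mat" where
  "mat_fun f A = (THE B. \<exists>U l. spectral_decomp (dim_row A) A U l \<and>
     B = U * real_diag (dim_row A) (\<lambda>i. f (l i)) * mat_adjoint U)"

definition trace_norm :: "complex mat \<Rightarrow> real" where
  "trace_norm A = Re (mat_trace (mat_fun sqrt (mat_adjoint A * A)))"

text \<open>Since \<open>ln 0 = 0\<close> in HOL, the convention \<open>0 log 0 = 0\<close> holds in the next two definitions,
  also on the kernel of \<open>\<rho>\<close>.\<close>

definition vN_entropy :: "complex mat \<Rightarrow> real" where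
  "vN_entropy \<rho> = - Re (mat_trace (\<rho> * mat_fun ln \<rho>))"

definition binary_entropy :: "real \<Rightarrow> real" where
  "binary_entropy \<epsilon> = - \<epsilon> * ln \<epsilon> - (1 - \<epsilon>) * ln (1 - \<epsilon>)"

text \<open>The support is the orthogonal complement of the kernel.\<close>

definition mat_support :: "complex mat \<Rightarrow> complex vec set" where
  "mat_support A = {v \<in> carrier_vec (dim_col A). \<forall>w\<in>mat_kernel A. v \<bullet>c w = 0}"

definition orthogonal_supports :: "complex mat \<Rightarrow> complex mat \<Rightarrow> bool" where
  "orthogonal_supports A B \<longleftrightarrow> (\<forall>v\<in>mat_support A. \<forall>w\<in>mat_support B. v \<bullet>c w = 0)"

text \<open>For \<open>\<epsilon> = 0\<close> this leaves \<open>\<rho>\<^sub>+\<close> and \<open>\<rho>\<^sub>-\<close> arbitrary states with orthogonal supports.\<close>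

definition normalized_jordan_hahn ::
  "nat \<Rightarrow> real \<Rightarrow> complex mat \<Rightarrow> complex mat \<Rightarrow> complex mat \<Rightarrow> complex mat \<Rightarrow> bool" where
  "normalized_jordan_hahn d \<epsilon> \<rho>1 \<rho>2 \<rho>p \<rho>m \<longleftrightarrow>
     \<rho>p \<in> density_mats d \<and> \<rho>m \<in> density_mats d \<and> orthogonal_supports \<rho>p \<rho>m \<and>
     \<rho>1 - \<rho>2 = complex_of_real \<epsilon> \<cdot>\<^sub>m \<rho>p - complex_of_real \<epsilon> \<cdot>\<^sub>m \<rho>m"

lemma real_diag_carrier [simp]: "real_diag d l \<in> carrier_mat d d"
  by (simp add: real_diag_def)

lemma mat_adjoint_carrier: "A \<in> carrier_mat m n \<Longrightarrow> mat_adjoint A \<in> carrier_mat n m"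
  by (auto simp: mat_adjoint_def mat_of_rows_def)

lemma spectral_decomp_unique:
  assumes U: "spectral_decomp d A U k" and V: "spectral_decomp d A V l"
  shows "U * real_diag d (\<lambda>i. f (k i)) * mat_adjoint U
       = V * real_diag d (\<lambda>i. f (l i)) * mat_adjoint V"
proof -
  let ?U' = "mat_adjoint U" and ?V' = "mat_adjoint V"
  define W where "W = ?V' * U"
  have uc: "U \<in> carrier_mat d d" "?U' \<in> carrier_mat d d" "?U' * U = 1\<^sub>m d" "U * ?U' = 1\<^sub>m d"
    and vc: "V \<in> carrier_mat d d" "?V' \<in> carrier_mat d d" "?V' * V = 1\<^sub>m d" "V * ?V' = 1\<^sub>m d"
    using U V by (auto simp: spectral_decomp_def unitary_mat_def mat_adjoint_carrier)
  have wc: "W \<in> carrier_mat d d" using uc vc by (simp add: W_def)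
  have assoc: "X * Y * Z = X * (Y * Z)"
    if "X \<in> carrier_mat d d" "Y \<in> carrier_mat d d" "Z \<in> carrier_mat d d" for X Y Z :: "complex mat"
    using that by (rule assoc_mult_mat)
  have closed: "X * Y \<in> carrier_mat d d"
    if "X \<in> carrier_mat d d" "Y \<in> carrier_mat d d" for X Y :: "complex mat"
    using that by (rule mult_carrier_mat)
  have cancel: "?U' * (U * X) = X" "V * (?V' * X) = X" "?V' * (V * X) = X"
    if "X \<in> carrier_mat d d" for X
    using that uc vc by (simp_all flip: assoc)
  have "U * real_diag d k * ?U' = V * real_diag d l * ?V'"
    using U V by (simp add: spectral_decomp_def)
  hence "?V' * (U * real_diag d k * ?U') * U = ?V' * (V * real_diag d l * ?V') * U" by simp
  hence eq: "W * real_diag d k = real_diag d l * W"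
    using uc vc by (simp add: W_def assoc closed cancel right_mult_one_mat[of _ d d])
  have "W * real_diag d (\<lambda>i. f (k i)) = real_diag d (\<lambda>i. f (l i)) * W"
  proof (rule eq_matI)
    fix i j assume "i < dim_row (real_diag d (\<lambda>i. f (l i)) * W)"
      and "j < dim_col (real_diag d (\<lambda>i. f (l i)) * W)"
    hence ij: "i < d" "j < d" using wc by (auto simp: real_diag_def mat_diag_def)
    have L: "(W * real_diag d g) $$ (i, j) = W $$ (i, j) * complex_of_real (g j)" for g
      unfolding real_diag_def using wc ij by (subst mat_diag_mult_right[of W d d]) auto
    have R: "(real_diag d g * W) $$ (i, j) = complex_of_real (g i) * W $$ (i, j)" for g
      unfolding real_diag_def using wc ij by (subst mat_diag_mult_left[of W d d]) auto
    have "W $$ (i, j) * complex_of_real (k j) = complex_of_real (l i) * W $$ (i, j)"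
      by (metis eq L R)
    hence "W $$ (i, j) = 0 \<or> l i = k j" by (metis mult.commute mult_cancel_left of_real_eq_iff)
    thus "(W * real_diag d (\<lambda>i. f (k i))) $$ (i, j) = (real_diag d (\<lambda>i. f (l i)) * W) $$ (i, j)"
      by (auto simp: L R)
  qed (use wc in \<open>auto simp: real_diag_def mat_diag_def\<close>)
  hence "V * (W * real_diag d (\<lambda>i. f (k i))) * ?U' = V * (real_diag d (\<lambda>i. f (l i)) * W) * ?U'"
    by simp
  thus ?thesis using uc vc by (simp add: W_def assoc closed cancel right_mult_one_mat[of _ d d])
qed

lemma mat_fun_eq:
  assumes "spectral_decomp d A U l"
  shows "mat_fun f A = U * real_diag d (\<lambda>i. f (l i)) * mat_adjoint U"
proof -
  have "U \<in> carrier_mat d d"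
    using assms by (simp add: spectral_decomp_def unitary_mat_def)
  hence "dim_row A = d"
    using assms by (simp add: spectral_decomp_def)
  thus ?thesis unfolding mat_fun_def
    using assms spectral_decomp_unique by (intro the_equality) blast+
qed

end

theory Submission
  imports Defs "Jordan_Normal_Form.Spectral_Radius"
begin

text \<open>Write \<open>P = \<epsilon> \<rho>\<^sub>+\<close>, \<open>N = \<epsilon> \<rho>\<^sub>-\<close> and \<open>W = \<rho>\<^sub>2 + P = \<rho>\<^sub>1 + N\<close>. Subadditivity gives
  \<open>S(W) \<le> S(\<rho>\<^sub>2) + S(P)\<close>. Conversely, measuring with the support projection \<open>Q\<close> of \<open>\<rho>\<^sub>+\<close>, for which
  \<open>N\<close> has outcome \<open>1 - Q\<close> with certainty, monotonicity of relative entropy bounds \<open>S(W)\<close> from below by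
  \<open>S(\<rho>\<^sub>1) + S(N)\<close> plus a classical information term. With \<open>s = 1 - Tr (\<rho>\<^sub>2 Q)\<close> the resulting
  error is \<open>s ln s - \<epsilon> ln \<epsilon> - (s - \<epsilon>) ln (s - \<epsilon>)\<close>, which is largest at \<open>s = 1\<close>, where it equals
  \<open>h(\<epsilon>)\<close>. Equality holds for \<open>\<rho>\<^sub>2\<close> pure and \<open>\<rho>\<^sub>1\<close> mixing it with an orthogonal pure state.\<close>

section \<open>Complex matrices, adjoints and traces\<close>

text \<open>Both bounds on S(W) concern the difference Tr (A ln A) - Tr (A ln W) for a summand A of
  W: A \<le> W makes it at most 0, and measuring bounds it from below by its classical value. Adding
  over the two summands, the second traces combine to -S(W). The obstacles are that the logarithm of
  a matrix is not accessible entrywise and that W may be singular. In eigenbases u_i of A and v_j of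
  W everything becomes a double sum with the weights |<u_i, v_j>|^2, and pairs in which W has
  eigenvalue 0 contribute nothing because A \<le> W. The operator inequality then enters only
  through quadratic forms and resolvents, the logarithm only through ln t \<le> t - 1 and its
  derivative.\<close>

lemma mat_adjoint_index [simp]:
  assumes "i < dim_col A" "j < dim_row A"
  shows "mat_adjoint A $$ (i, j) = cnj (A $$ (j, i))"
  using assms by (simp add: mat_adjoint_def mat_of_rows_def)

lemma mat_adjoint_dim [simp]:
  "dim_row (mat_adjoint A) = dim_col A" "dim_col (mat_adjoint A) = dim_row A"
  by (simp_all add: mat_adjoint_def)

lemma mat_adjoint_adjoint [simp]: "mat_adjoint (mat_adjoint A) = (A :: complex mat)"
  by (rule eq_matI) auto

lemma mult_mat_index_sum:
  assumes "A \<in> carrier_mat m n" "B \<in> carrier_mat n k" "i < m" "j < k"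
  shows "(A * B) $$ (i, j) = (\<Sum>l<n. A $$ (i, l) * B $$ (l, j))"
  using assms by (auto simp: scalar_prod_def atLeast0LessThan)

lemma mat_adjoint_mult:
  fixes A B :: "complex mat"
  assumes "A \<in> carrier_mat m n" "B \<in> carrier_mat n k"
  shows "mat_adjoint (A * B) = mat_adjoint B * mat_adjoint A"
  using assms by (intro eq_matI) (auto simp: scalar_prod_def mult.commute)

lemma mat_adjoint_one [simp]: "mat_adjoint (1\<^sub>m n) = (1\<^sub>m n :: complex mat)"
  by (rule eq_matI) auto

lemma mat_adjoint_real_diag [simp]: "mat_adjoint (real_diag d l) = real_diag d l"
  by (rule eq_matI) (auto simp: real_diag_def mat_diag_def)

lemma real_diag_index [simp]:
  "i < d \<Longrightarrow> j < d \<Longrightarrow> real_diag d l $$ (i, j) = (if i = j then complex_of_real (l j) else 0)"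
  by (simp add: real_diag_def mat_diag_def)

lemma real_diag_dim [simp]: "dim_row (real_diag d l) = d" "dim_col (real_diag d l) = d"
  by (simp_all add: real_diag_def mat_diag_def)

lemma real_diag_mult_left_index:
  assumes "M \<in> carrier_mat d n" "i < d" "j < n"
  shows "(real_diag d l * M) $$ (i, j) = complex_of_real (l i) * M $$ (i, j)"
  unfolding real_diag_def using assms by (subst mat_diag_mult_left) auto

lemma mat_trace_mult_comm:
  fixes A B :: "complex mat"
  assumes "A \<in> carrier_mat m n" "B \<in> carrier_mat n m"
  shows "mat_trace (A * B) = mat_trace (B * A)"
proof -
  have "mat_trace (A * B) = (\<Sum>i<m. \<Sum>l<n. A $$ (i, l) * B $$ (l, i))"
    using assms by (auto simp: mat_trace_def mult_mat_index_sum[of A m n B m] simp del: index_mult_mat(1)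
        intro!: sum.cong)
  also have "\<dots> = (\<Sum>l<n. \<Sum>i<m. B $$ (l, i) * A $$ (i, l))"
    by (subst sum.swap) (simp add: mult.commute)
  also have "\<dots> = mat_trace (B * A)"
    using assms by (auto simp: mat_trace_def mult_mat_index_sum[of B n m A n] simp del: index_mult_mat(1)
        intro!: sum.cong)
  finally show ?thesis .
qed

lemma mat_trace_add:
  fixes A B :: "complex mat"
  assumes "A \<in> carrier_mat n n" "B \<in> carrier_mat n n"
  shows "mat_trace (A + B) = mat_trace A + mat_trace B"
  using assms by (simp add: mat_trace_def sum.distrib)

lemma mat_trace_minus:
  fixes A B :: "complex mat"
  assumes "A \<in> carrier_mat n n" "B \<in> carrier_mat n n"
  shows "mat_trace (A - B) = mat_trace A - mat_trace B"
  using assms by (simp add: mat_trace_def sum_subtractf)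

lemma mat_trace_smult: "mat_trace (c \<cdot>\<^sub>m A) = c * mat_trace (A :: complex mat)" if "A \<in> carrier_mat n n"
  using that by (simp add: mat_trace_def sum_distrib_left)

lemma mult_carrier [intro]:
  "A \<in> carrier_mat d d \<Longrightarrow> B \<in> carrier_mat d d \<Longrightarrow> A * B \<in> carrier_mat d d"
  by (rule mult_carrier_mat)

lemma adjoint_carrier [intro]: "A \<in> carrier_mat d d \<Longrightarrow> mat_adjoint A \<in> carrier_mat d d"
  by (rule mat_adjoint_carrier)

lemma mult_adjoint_index:
  assumes "Y \<in> carrier_mat n k" "i < n"
  shows "(Y * mat_adjoint Y) $$ (i, i) = (\<Sum>l<k. complex_of_real ((cmod (Y $$ (i, l)))\<^sup>2))"
  using assms by (subst mult_mat_index_sum[of _ n k _ n])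
    (auto simp: mat_adjoint_carrier complex_norm_square simp del: of_real_power intro!: sum.cong)

lemma adjoint_diag_index:
  assumes "Y \<in> carrier_mat d k" "i < k"
  shows "(mat_adjoint Y * real_diag d l * Y) $$ (i, i)
    = (\<Sum>j<d. complex_of_real (l j * (cmod (Y $$ (j, i)))\<^sup>2))"
proof -
  have "(mat_adjoint Y * (real_diag d l * Y)) $$ (i, i)
      = (\<Sum>j<d. mat_adjoint Y $$ (i, j) * (real_diag d l * Y) $$ (j, i))"
    using assms by (intro mult_mat_index_sum) (auto simp: mat_adjoint_carrier)
  also have "\<dots> = (\<Sum>j<d. complex_of_real (l j * (cmod (Y $$ (j, i)))\<^sup>2))"
    using assms by (intro sum.cong refl)
      (simp add: real_diag_mult_left_index[OF assms(1)] complex_norm_square mult_ac del: index_mult_mat(1) of_real_power)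
  finally show ?thesis
    using assms by (subst assoc_mult_mat[of _ k d _ d _ k]) (auto simp: mat_adjoint_carrier)
qed

section \<open>Unitary matrices\<close>

lemma unitary_matD:
  assumes "unitary_mat d U"
  shows "U \<in> carrier_mat d d" "mat_adjoint U \<in> carrier_mat d d"
    "mat_adjoint U * U = 1\<^sub>m d" "U * mat_adjoint U = 1\<^sub>m d"
  using assms by (auto simp: unitary_mat_def)

lemma unitary_matI:
  assumes "U \<in> carrier_mat d d" "mat_adjoint U * U = 1\<^sub>m d"
  shows "unitary_mat d U"
  using assms mat_mult_left_right_inverse[of "mat_adjoint U" d U]
  by (auto simp: unitary_mat_def)

lemma unitary_mat_mult:
  assumes "unitary_mat d U" "unitary_mat d V"
  shows "unitary_mat d (U * V)"
proof (rule unitary_matI)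
  note u = unitary_matD[OF assms(1)] and v = unitary_matD[OF assms(2)]
  show "U * V \<in> carrier_mat d d" using u v by auto
  have "mat_adjoint (U * V) * (U * V) = mat_adjoint V * (mat_adjoint U * (U * V))"
    using u v by (simp add: mat_adjoint_mult[of U d d V d] assoc_mult_mat[of _ d d _ d _ d] mult_carrier)
  also have "mat_adjoint U * (U * V) = (mat_adjoint U * U) * V"
    using u v by (intro assoc_mult_mat[symmetric])
  finally have "mat_adjoint (U * V) * (U * V) = mat_adjoint V * ((mat_adjoint U * U) * V)" .
  thus "mat_adjoint (U * V) * (U * V) = 1\<^sub>m d"
    using u v by simp
qed

lemma unitary_mat_adjoint: "unitary_mat d U \<Longrightarrow> unitary_mat d (mat_adjoint U)"
  by (auto simp: unitary_mat_def)

lemma unitary_col_norm: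
  assumes "unitary_mat d U" "j < d"
  shows "(\<Sum>i<d. (cmod (U $$ (i, j)))\<^sup>2) = 1"
proof -
  note u = unitary_matD[OF assms(1)]
  have "complex_of_real (\<Sum>i<d. (cmod (U $$ (i, j)))\<^sup>2) = (mat_adjoint U * U) $$ (j, j)"
    using u assms(2) by (subst mult_mat_index_sum[of _ d d _ d])
      (auto simp: complex_norm_square mult_ac simp del: of_real_power intro!: sum.cong)
  also have "\<dots> = complex_of_real 1" using u assms(2) by simp
  finally show ?thesis by (simp only: of_real_eq_iff)
qed

lemma unitary_row_norm:
  assumes "unitary_mat d U" "i < d"
  shows "(\<Sum>j<d. (cmod (U $$ (i, j)))\<^sup>2) = 1"
  using unitary_col_norm[OF unitary_mat_adjoint[OF assms(1)] assms(2)] assms(2)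
    unitary_matD(1)[OF assms(1)] by simp

section \<open>The spectral theorem\<close>

lemma hermitian_mat_index:
  assumes "hermitian_mat A" "A \<in> carrier_mat d d" "i < d" "j < d"
  shows "A $$ (i, j) = cnj (A $$ (j, i))"
  using assms by (metis carrier_matD mat_adjoint_index hermitian_mat_def)

lemma hermitian_sandwich:
  assumes "hermitian_mat A" "A \<in> carrier_mat d d" "Y \<in> carrier_mat d k"
  shows "hermitian_mat (mat_adjoint Y * A * Y)"
proof -
  have "mat_adjoint (mat_adjoint Y * A * Y) = mat_adjoint Y * (mat_adjoint A * Y)"
    using assms by (simp add: mat_adjoint_mult[of _ k d _ k] mat_adjoint_mult[of _ k d _ d] mat_adjoint_carrier
        mult_carrier_mat[of _ k d _ d])
  thus ?thesis
    using assms by (simp add: hermitian_mat_def assoc_mult_mat[of _ k d _ d _ k] mat_adjoint_carrier)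
qed

lemma sandwich_index:
  assumes "A \<in> carrier_mat d d" "Y \<in> carrier_mat d n" "i < n" "j < n"
  shows "(mat_adjoint Y * A * Y) $$ (i, j)
    = (\<Sum>k<d. \<Sum>l<d. cnj (Y $$ (k, i)) * A $$ (k, l) * Y $$ (l, j))"
proof -
  have "(mat_adjoint Y * (A * Y)) $$ (i, j)
      = (\<Sum>k<d. mat_adjoint Y $$ (i, k) * (A * Y) $$ (k, j))"
    using assms by (intro mult_mat_index_sum) (auto simp: mat_adjoint_carrier)
  also have "\<dots> = (\<Sum>k<d. \<Sum>l<d. cnj (Y $$ (k, i)) * A $$ (k, l) * Y $$ (l, j))"
    using assms by (intro sum.cong refl)
      (simp add: mult_mat_index_sum[OF assms(1,2)] sum_distrib_left mult.assoc del: index_mult_mat(1))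
  finally show ?thesis
    using assms by (subst assoc_mult_mat[of _ n d _ d _ n]) (auto simp: mat_adjoint_carrier)
qed

lemma unitary_conjugation_cancel:
  assumes "unitary_mat d U" "A \<in> carrier_mat d d"
  shows "U * (mat_adjoint U * A * U) * mat_adjoint U = A"
    and "mat_adjoint U * (U * A * mat_adjoint U) * U = A"
proof -
  note u = unitary_matD[OF assms(1)]
  have "U * (mat_adjoint U * A * U) * mat_adjoint U
      = (U * mat_adjoint U) * (A * (U * mat_adjoint U))"
    using u(1,2) assms(2) by (simp add: assoc_mult_mat[of _ d d _ d _ d] mult_carrier)
  thus "U * (mat_adjoint U * A * U) * mat_adjoint U = A" using u assms(2) by simp
  have "mat_adjoint U * (U * A * mat_adjoint U) * U
      = (mat_adjoint U * U) * (A * (mat_adjoint U * U))"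
    using u(1,2) assms(2) by (simp add: assoc_mult_mat[of _ d d _ d _ d] mult_carrier)
  thus "mat_adjoint U * (U * A * mat_adjoint U) * U = A" using u assms(2) by simp
qed

text \<open>Gram-Schmidt keeps the first vector of a basis, so completing \<open>v\<close> to a
  basis and orthogonalising leaves \<open>v\<close> in front. \<open>corthogonal\<close> gives
  orthogonal nonzero vectors but not unit ones; the scalar \<open>c\<close> comes from dividing each
  by its norm.\<close>

lemma unitary_mat_with_first_col:
  fixes v :: "complex vec"
  assumes v: "v \<in> carrier_vec n" "v \<noteq> 0\<^sub>v n" and n: "0 < n"
  obtains W c where "unitary_mat n W" "col W 0 = c \<cdot>\<^sub>v v"
proof -
  interpret cof_vec_space n "TYPE(complex)" .
  define b where "b = basis_completion v"
  define ws where "ws = gram_schmidt n b"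
  from basis_completion[OF v, folded b_def]
  have dist_b: "distinct b" and indep: "\<not> lin_dep (set b)" and b: "set b \<subseteq> carrier_vec n"
    and hdb: "hd b = v" and len_b: "length b = n" by auto
  from hdb len_b n obtain vs where bv: "b = v # vs" by (cases b) auto
  from gram_schmidt_result[OF b dist_b indep refl, folded ws_def]
  have ws: "set ws \<subseteq> carrier_vec n" "corthogonal ws" "length ws = n"
    by (auto simp: len_b)
  from gram_schmidt_hd[OF v(1), of vs, folded bv] have hdws: "hd ws = v" unfolding ws_def .
  hence ws0: "ws ! 0 = v" using ws(3) n by (cases ws) auto
  define r where "r j = sqrt (Re (ws ! j \<bullet>c ws ! j))" for j
  have car: "ws ! j \<in> carrier_vec n" if "j < n" for j using ws that by auto
  have r: "complex_of_real (r j) * complex_of_real (r j) = ws ! j \<bullet>c ws ! j" "r j \<noteq> 0" if "j < n" for j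
  proof -
    have "0 \<le> ws ! j \<bullet>c ws ! j" "ws ! j \<bullet>c ws ! j \<noteq> 0"
      using conjugate_square_ge_0_vec corthogonalD[OF ws(2), of j j] ws(3) that by auto
    hence *: "0 < Re (ws ! j \<bullet>c ws ! j)" "Im (ws ! j \<bullet>c ws ! j) = 0"
      by (auto simp: less_eq_complex_def complex_eq_iff)
    thus "r j \<noteq> 0" by (simp add: r_def)
    have "complex_of_real (r j) * complex_of_real (r j) = complex_of_real (r j * r j)" by simp
    also have "\<dots> = ws ! j \<bullet>c ws ! j"
      using * by (simp add: r_def complex_eq_iff)
    finally show "complex_of_real (r j) * complex_of_real (r j) = ws ! j \<bullet>c ws ! j" .
  qed
  define W where "W = Matrix.mat n n (\<lambda>(i, j). ws ! j $ i / complex_of_real (r j))"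
  have W: "W \<in> carrier_mat n n" by (simp add: W_def)
  have "mat_adjoint W * W = 1\<^sub>m n"
  proof (rule eq_matI)
    fix i j assume "i < dim_row (1\<^sub>m n :: complex mat)" "j < dim_col (1\<^sub>m n :: complex mat)"
    hence ij: "i < n" "j < n" by auto
    have "(mat_adjoint W * W) $$ (i, j) = (\<Sum>k<n. cnj (W $$ (k, i)) * W $$ (k, j))"
      using W ij by (subst mult_mat_index_sum[of _ n n _ n]) auto
    also have "\<dots> = (\<Sum>k<n. ws ! j $ k * cnj (ws ! i $ k)) / (complex_of_real (r i) * complex_of_real (r j))"
      using ij by (simp add: W_def sum_divide_distrib mult_ac)
    also have "(\<Sum>k<n. ws ! j $ k * cnj (ws ! i $ k)) = ws ! j \<bullet>c ws ! i"
      using car[OF ij(1)] car[OF ij(2)] by (auto simp: scalar_prod_def atLeast0LessThan)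
    also have "\<dots> / (complex_of_real (r i) * complex_of_real (r j)) = 1\<^sub>m n $$ (i, j)"
      using corthogonalD[OF ws(2), of j i] ws(3) ij r[OF ij(1)] by auto
    finally show "(mat_adjoint W * W) $$ (i, j) = 1\<^sub>m n $$ (i, j)" .
  qed (use W in auto)
  hence "unitary_mat n W" using W by (intro unitary_matI)
  moreover have "col W 0 = (1 / complex_of_real (r 0)) \<cdot>\<^sub>v v"
    using v n by (intro eq_vecI) (auto simp: W_def ws0)
  ultimately show ?thesis by (rule that)
qed

text \<open>Deflation: in an orthonormal basis that starts with an eigenvector, the first column
  vanishes below the diagonal, and by hermiticity so does the first row. The remaining block is
  again Hermitian, so the induction applies to it.\<close>

lemma unitary_diagonalization:
  assumes "A \<in> carrier_mat d d" "hermitian_mat A"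
  shows "\<exists>U. unitary_mat d U \<and> (\<forall>i<d. \<forall>j<d. i \<noteq> j \<longrightarrow> (mat_adjoint U * A * U) $$ (i, j) = 0)"
  using assms
proof (induction d arbitrary: A)
  case 0
  show ?case by (intro exI[of _ "1\<^sub>m 0"]) (auto simp: unitary_mat_def)
next
  case (Suc d)
  note A = Suc.prems(1) and hA = Suc.prems(2)
  obtain e v where "eigenvector A v e"
    using spectrum_non_empty[OF A] unfolding spectrum_def eigenvalue_def by auto
  hence v: "v \<in> carrier_vec (Suc d)" "v \<noteq> 0\<^sub>v (Suc d)" "A *\<^sub>v v = e \<cdot>\<^sub>v v"
    using A by (auto simp: eigenvector_def)
  obtain W c where W: "unitary_mat (Suc d) W" and W0: "col W 0 = c \<cdot>\<^sub>v v"
    using unitary_mat_with_first_col[OF v(1,2)] by auto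
  note w = unitary_matD[OF W]
  define A' where "A' = mat_adjoint W * A * W"
  have A': "A' \<in> carrier_mat (Suc d) (Suc d)" "hermitian_mat A'"
    unfolding A'_def using w A hermitian_sandwich[OF hA A w(1)] by blast+
  have AW: "col (A * W) 0 = e \<cdot>\<^sub>v col W 0"
  proof -
    have "col (A * W) 0 = A *\<^sub>v col W 0" using A w by (intro col_mult2) auto
    also have "\<dots> = c \<cdot>\<^sub>v (A *\<^sub>v v)" unfolding W0 using A v by (intro mult_mat_vec) auto
    also have "\<dots> = e \<cdot>\<^sub>v col W 0" using v by (simp add: W0 smult_smult_assoc mult.commute)
    finally show ?thesis .
  qed
  \<comment> \<open>Column 0 of \<open>W\<close> is an eigenvector, so column 0 of \<open>A'\<close>
    is \<open>e\<close> times column 0 of \<open>mat_adjoint W * W\<close>, the identity.\<close>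
  have A'0: "A' $$ (i, 0) = 0" if "i < Suc d" "i \<noteq> 0" for i
  proof -
    have "A' = mat_adjoint W * (A * W)"
      using w A by (simp add: A'_def assoc_mult_mat[of _ "Suc d" "Suc d" _ "Suc d" _ "Suc d"])
    hence "A' $$ (i, 0) = row (mat_adjoint W) i \<bullet> col (A * W) 0"
      using w A that by simp
    also have "\<dots> = e * (row (mat_adjoint W) i \<bullet> col W 0)"
      unfolding AW using w that by (subst scalar_prod_smult_distrib[of _ "Suc d"]) (auto intro!: carrier_vecI)
    also have "row (mat_adjoint W) i \<bullet> col W 0 = (mat_adjoint W * W) $$ (i, 0)"
      using w(1) that by simp
    also have "\<dots> = 0" using that by (simp add: w(3))
    finally show ?thesis by simp
  qed
  have A'0': "A' $$ (0, i) = 0" if "i < Suc d" "i \<noteq> 0" for i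
    using hermitian_mat_index[OF A'(2,1), of 0 i] A'0[OF that] that by simp
  define A3 where "A3 = Matrix.mat d d (\<lambda>(i, j). A' $$ (Suc i, Suc j))"
  have A3: "A3 \<in> carrier_mat d d" by (simp add: A3_def)
  have "hermitian_mat A3" unfolding hermitian_mat_def
    by (intro eq_matI) (auto simp: A3_def hermitian_mat_index[OF A'(2,1), symmetric])
  then obtain U3 where U3: "unitary_mat d U3"
    and D3: "\<And>i j. i < d \<Longrightarrow> j < d \<Longrightarrow> i \<noteq> j \<Longrightarrow> (mat_adjoint U3 * A3 * U3) $$ (i, j) = 0"
    using Suc.IH[OF A3] by auto
  note u3 = unitary_matD[OF U3]
  \<comment> \<open>The block matrix diag(1, \<open>U3\<close>): it fixes the eigenvector already
    split off and diagonalises the remaining block.\<close>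
  define Q where "Q = Matrix.mat (Suc d) (Suc d) (\<lambda>(i, j). case (i, j) of
      (Suc i', Suc j') \<Rightarrow> U3 $$ (i', j') | (0, 0) \<Rightarrow> 1 | _ \<Rightarrow> 0)"
  have Q: "Q \<in> carrier_mat (Suc d) (Suc d)" by (simp add: Q_def)
  have Qi: "Q $$ (0, 0) = 1" "\<And>j. j < d \<Longrightarrow> Q $$ (0, Suc j) = 0" "\<And>i. i < d \<Longrightarrow> Q $$ (Suc i, 0) = 0"
    "\<And>i j. i < d \<Longrightarrow> j < d \<Longrightarrow> Q $$ (Suc i, Suc j) = U3 $$ (i, j)"
    by (auto simp: Q_def)
  have QQ: "mat_adjoint Q * Q = 1\<^sub>m (Suc d)"
  proof (rule eq_matI)
    fix i j assume "i < dim_row (1\<^sub>m (Suc d) :: complex mat)" "j < dim_col (1\<^sub>m (Suc d) :: complex mat)"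
    hence ij: "i < Suc d" "j < Suc d" by auto
    have U3i: "(\<Sum>k<d. cnj (U3 $$ (k, i')) * U3 $$ (k, j')) = 1\<^sub>m d $$ (i', j')" if "i' < d" "j' < d" for i' j'
    proof -
      have "(\<Sum>k<d. cnj (U3 $$ (k, i')) * U3 $$ (k, j')) = (mat_adjoint U3 * U3) $$ (i', j')"
        using u3(1) that by (subst mult_mat_index_sum[of _ d d _ d]) auto
      thus ?thesis using u3(3) by simp
    qed
    have "(mat_adjoint Q * Q) $$ (i, j) = (\<Sum>k<Suc d. cnj (Q $$ (k, i)) * Q $$ (k, j))"
      using Q ij by (subst mult_mat_index_sum[of _ "Suc d" "Suc d" _ "Suc d"]) auto
    also have "\<dots> = 1\<^sub>m (Suc d) $$ (i, j)"
      using ij U3i by (cases i; cases j) (auto simp: sum.lessThan_Suc_shift Qi simp del: sum.lessThan_Suc)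
    finally show "(mat_adjoint Q * Q) $$ (i, j) = 1\<^sub>m (Suc d) $$ (i, j)" .
  qed (use Q in auto)
  have UQ: "unitary_mat (Suc d) Q" using Q QQ by (rule unitary_matI)
  have "mat_adjoint (W * Q) * A * (W * Q) = mat_adjoint Q * A' * Q"
    using w(1,2) Q A unfolding A'_def
    by (simp add: mat_adjoint_mult[of _ "Suc d" "Suc d" _ "Suc d"] mult_carrier adjoint_carrier
        assoc_mult_mat[of _ "Suc d" "Suc d" _ "Suc d" _ "Suc d"])
  moreover have "(mat_adjoint Q * A' * Q) $$ (i, j) = 0" if ij: "i < Suc d" "j < Suc d" "i \<noteq> j" for i j
  proof -
    have "(mat_adjoint Q * A' * Q) $$ (i, j)
        = (\<Sum>k<Suc d. \<Sum>l<Suc d. cnj (Q $$ (k, i)) * A' $$ (k, l) * Q $$ (l, j))"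
      using A' Q ij by (intro sandwich_index) auto
    also have "\<dots> = 0"
    proof (cases i; cases j)
      fix i' j' assume [simp]: "i = Suc i'" "j = Suc j'"
      have "(\<Sum>k<d. \<Sum>l<d. cnj (U3 $$ (k, i')) * A3 $$ (k, l) * U3 $$ (l, j'))
          = (mat_adjoint U3 * A3 * U3) $$ (i', j')"
        using ij A3 u3(1) by (intro sandwich_index[symmetric]) auto
      also have "\<dots> = 0" using ij by (intro D3) auto
      finally show ?thesis using ij
        by (simp add: sum.lessThan_Suc_shift Qi A3_def del: sum.lessThan_Suc)
    qed (use ij A'0 A'0' in \<open>auto simp: sum.lessThan_Suc_shift Qi simp del: sum.lessThan_Suc\<close>)
    finally show ?thesis .
  qed
  ultimately show ?case
    using unitary_mat_mult[OF W UQ] by (intro exI[of _ "W * Q"]) auto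
qed

lemma spectral_decomp_exists:
  assumes "A \<in> carrier_mat d d" "hermitian_mat A"
  obtains U l where "spectral_decomp d A U l"
proof -
  obtain U where U: "unitary_mat d U"
    and D: "\<And>i j. i < d \<Longrightarrow> j < d \<Longrightarrow> i \<noteq> j \<Longrightarrow> (mat_adjoint U * A * U) $$ (i, j) = 0"
    using unitary_diagonalization[OF assms] by blast
  note u = unitary_matD[OF U]
  let ?D = "mat_adjoint U * A * U"
  have h: "hermitian_mat ?D" "?D \<in> carrier_mat d d"
    using hermitian_sandwich[OF assms(2,1) u(1)] u assms(1) by auto
  have "?D = real_diag d (\<lambda>i. Re (?D $$ (i, i)))" (is "_ = ?R")
  proof (rule eq_matI)
    fix i j assume "i < dim_row ?R" "j < dim_col ?R"
    hence ij: "i < d" "j < d" by auto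
    have "Im (?D $$ (i, i)) = Im (cnj (?D $$ (i, i)))"
      by (rule arg_cong[OF hermitian_mat_index[OF h ij(1) ij(1)]])
    hence "Im (?D $$ (i, i)) = 0" by simp
    thus "?D $$ (i, j) = ?R $$ (i, j)"
      using D[OF ij] ij by (cases "i = j") (simp_all add: complex_eq_iff del: index_mult_mat)
  qed (use u in auto)
  hence "A = U * ?R * mat_adjoint U"
    using unitary_conjugation_cancel(1)[OF U assms(1)] by simp
  thus ?thesis using U that unfolding spectral_decomp_def by blast
qed

section \<open>Operator monotonicity of the logarithm under the trace\<close>

lemma mat_trace_real_diag_mult:
  assumes "M \<in> carrier_mat d d"
  shows "Re (mat_trace (real_diag d l * M)) = (\<Sum>i<d. l i * Re (M $$ (i, i)))"
  using assms by (auto simp: mat_trace_def real_diag_mult_left_index[OF assms] simp del: index_mult_mat(1))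

lemma spectral_decompD:
  assumes "spectral_decomp d A U l"
  shows "unitary_mat d U" "A = U * real_diag d l * mat_adjoint U" "A \<in> carrier_mat d d"
proof -
  show U: "unitary_mat d U" and A: "A = U * real_diag d l * mat_adjoint U"
    using assms by (auto simp: spectral_decomp_def)
  show "A \<in> carrier_mat d d"
    unfolding A using unitary_matD(1,2)[OF U] by (intro mult_carrier real_diag_carrier)
qed

lemma spectral_decomp_diag:
  assumes "spectral_decomp d A U l"
  shows "mat_adjoint U * A * U = real_diag d l"
  using unitary_conjugation_cancel(2)[of d U "real_diag d l"] spectral_decompD[OF assms] by simp

lemma spectral_trace_mult:
  assumes "spectral_decomp d A U l" "M \<in> carrier_mat d d"
  shows "Re (mat_trace (A * M)) = (\<Sum>i<d. l i * Re ((mat_adjoint U * M * U) $$ (i, i)))"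
proof -
  note s = spectral_decompD[OF assms(1)] and u = unitary_matD[OF spectral_decompD(1)[OF assms(1)]]
  have "A * M = U * (real_diag d l * (mat_adjoint U * M))"
    using u(1,2) assms(2) by (simp add: s(2) assoc_mult_mat[of _ d d _ d _ d] mult_carrier)
  hence "mat_trace (A * M) = mat_trace (real_diag d l * (mat_adjoint U * M) * U)"
    using u(1,2) assms(2) by (simp add: mat_trace_mult_comm[of U d d] mult_carrier)
  also have "real_diag d l * (mat_adjoint U * M) * U = real_diag d l * (mat_adjoint U * M * U)"
    using u(1,2) assms(2) by (intro assoc_mult_mat) auto
  finally show ?thesis
    using u(1,2) assms(2) by (simp add: mat_trace_real_diag_mult mult_carrier)
qed

lemma spectral_trace:
  assumes "spectral_decomp d A U l"
  shows "Re (mat_trace A) = (\<Sum>i<d. l i)"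
proof -
  note s = spectral_decompD[OF assms]
  have "Re (mat_trace (A * 1\<^sub>m d)) = (\<Sum>i<d. l i * Re ((mat_adjoint U * 1\<^sub>m d * U) $$ (i, i)))"
    by (rule spectral_trace_mult[OF assms]) auto
  also have "mat_adjoint U * 1\<^sub>m d * U = 1\<^sub>m d" using unitary_matD[OF s(1)] by simp
  finally show ?thesis by (simp add: right_mult_one_mat[OF s(3)])
qed

lemma vN_entropy_eq:
  assumes "spectral_decomp d A U l"
  shows "vN_entropy A = - (\<Sum>i<d. l i * ln (l i))"
proof -
  note s = spectral_decompD[OF assms] and u = unitary_matD[OF spectral_decompD(1)[OF assms]]
  have "Re (mat_trace (A * mat_fun ln A))
      = (\<Sum>i<d. l i * Re ((mat_adjoint U * (U * real_diag d (\<lambda>i. ln (l i)) * mat_adjoint U) * U) $$ (i, i)))"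
    using u by (simp add: mat_fun_eq[OF assms] spectral_trace_mult[OF assms] mult_carrier)
  thus ?thesis
    by (simp add: vN_entropy_def unitary_conjugation_cancel(2)[OF s(1) real_diag_carrier])
qed

text \<open>With z the column \<open>i\<close> of \<open>Z\<close>, this expands <z, A z> in the
  eigenbasis u_k of \<open>A\<close>, with weights |<u_k, z>|^2. Leaving \<open>Z\<close> arbitrary
  covers both the eigenbasis of another operator and the resolvent vectors used below.\<close>

lemma spectral_sandwich_index:
  assumes "spectral_decomp d A U l" "Z \<in> carrier_mat d n" "i < n"
  shows "Re ((mat_adjoint Z * A * Z) $$ (i, i)) = (\<Sum>k<d. l k * (cmod ((mat_adjoint U * Z) $$ (k, i)))\<^sup>2)"
proof -
  note s = spectral_decompD[OF assms(1)] and u = unitary_matD[OF spectral_decompD(1)[OF assms(1)]]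
  note UZ = mult_carrier_mat[OF u(2) assms(2)] and Z' = mat_adjoint_carrier[OF assms(2)]
  have "mat_adjoint (mat_adjoint U * Z) * real_diag d l * (mat_adjoint U * Z)
      = (mat_adjoint Z * U) * real_diag d l * (mat_adjoint U * Z)"
    using mat_adjoint_mult[OF u(2) assms(2)] by simp
  also have "\<dots> = (mat_adjoint Z * U) * (real_diag d l * (mat_adjoint U * Z))"
    by (rule assoc_mult_mat[OF mult_carrier_mat[OF Z' u(1)] real_diag_carrier UZ])
  also have "\<dots> = mat_adjoint Z * (U * (real_diag d l * (mat_adjoint U * Z)))"
    by (rule assoc_mult_mat[OF Z' u(1) mult_carrier_mat[OF real_diag_carrier UZ]])
  also have "real_diag d l * (mat_adjoint U * Z) = (real_diag d l * mat_adjoint U) * Z"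
    by (rule assoc_mult_mat[OF real_diag_carrier u(2) assms(2), symmetric])
  also have "U * \<dots> = (U * (real_diag d l * mat_adjoint U)) * Z"
    by (rule assoc_mult_mat[OF u(1) mult_carrier_mat[OF real_diag_carrier u(2)] assms(2), symmetric])
  also have "U * (real_diag d l * mat_adjoint U) = A"
    unfolding s(2) by (rule assoc_mult_mat[OF u(1) real_diag_carrier u(2), symmetric])
  also have "mat_adjoint Z * (A * Z) = mat_adjoint Z * A * Z"
    by (rule assoc_mult_mat[OF Z' s(3) assms(2), symmetric])
  finally have "(mat_adjoint Z * A * Z) $$ (i, i)
      = (mat_adjoint (mat_adjoint U * Z) * real_diag d l * (mat_adjoint U * Z)) $$ (i, i)" by simp
  also have "\<dots> = (\<Sum>k<d. complex_of_real (l k * (cmod ((mat_adjoint U * Z) $$ (k, i)))\<^sup>2))"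
    using UZ assms(3) by (intro adjoint_diag_index) auto
  finally show ?thesis by (simp del: of_real_mult of_real_power)
qed

lemma psd_matD:
  assumes "psd_mat d A"
  shows "A \<in> carrier_mat d d" "hermitian_mat A"
  using assms by (auto simp: psd_mat_def)

lemma psd_sandwich_index:
  assumes "psd_mat d A" "Z \<in> carrier_mat d n" "i < n"
  shows "0 \<le> Re ((mat_adjoint Z * A * Z) $$ (i, i))"
proof -
  note a = psd_matD[OF assms(1)]
  have "(mat_adjoint Z * A * Z) $$ (i, i) = (mat_adjoint Z * (A * Z)) $$ (i, i)"
    using a assms by (simp add: assoc_mult_mat[of _ n d _ d _ n] mat_adjoint_carrier)
  also have "\<dots> = (\<Sum>k<d. cnj (Z $$ (k, i)) * (A * Z) $$ (k, i))"
    using a assms(2,3) by (subst mult_mat_index_sum[of _ n d _ n])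
      (auto simp: mat_adjoint_carrier)
  also have "\<dots> = (A *\<^sub>v col Z i) \<bullet>c col Z i"
    using a assms(2,3) by (auto simp: scalar_prod_def atLeast0LessThan intro!: sum.cong)
  finally show ?thesis
    using assms by (simp add: psd_mat_def)
qed

lemma spectral_psd_nonneg:
  assumes "spectral_decomp d A U l" "psd_mat d A" "i < d"
  shows "0 \<le> l i"
proof -
  have "0 \<le> Re ((mat_adjoint U * A * U) $$ (i, i))"
    using assms unitary_matD[OF spectral_decompD(1)[OF assms(1)]] by (intro psd_sandwich_index) auto
  thus ?thesis using assms(3) by (simp add: spectral_decomp_diag[OF assms(1)])
qed

lemma sandwich_add:
  assumes "A \<in> carrier_mat d d" "B \<in> carrier_mat d d" "Z \<in> carrier_mat d n"
  shows "mat_adjoint Z * (A + B) * Z = mat_adjoint Z * A * Z + mat_adjoint Z * B * Z"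
  using assms by (simp add: mult_add_distrib_mat[of _ n d _ d] add_mult_distrib_mat[of _ n d _ _ n]
      mat_adjoint_carrier mult_carrier_mat[of _ n d _ d])

lemma sandwich_minus:
  assumes "A \<in> carrier_mat d d" "B \<in> carrier_mat d d" "Z \<in> carrier_mat d n"
  shows "mat_adjoint Z * (A - B) * Z = mat_adjoint Z * A * Z - mat_adjoint Z * B * Z"
  using assms by (simp add: mult_minus_distrib_mat[of _ n d _ d] minus_mult_distrib_mat[of _ n d _ _ n]
      mat_adjoint_carrier mult_carrier_mat[of _ n d _ d])

text \<open>The trace of \<open>A ln W\<close> for \<open>W\<close> with eigenbasis \<open>V\<close> and eigenvalues \<open>q\<close>; kernel vectors of \<open>W\<close>
  contribute \<open>0\<close> because \<open>ln 0 = 0\<close>.\<close>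

definition cross_ln :: "nat \<Rightarrow> complex mat \<Rightarrow> complex mat \<Rightarrow> (nat \<Rightarrow> real) \<Rightarrow> real" where
  "cross_ln d A V q = (\<Sum>j<d. Re ((mat_adjoint V * A * V) $$ (j, j)) * ln (q j))"

lemma cross_ln_add:
  assumes "A \<in> carrier_mat d d" "B \<in> carrier_mat d d" "V \<in> carrier_mat d d"
  shows "cross_ln d (A + B) V q = cross_ln d A V q + cross_ln d B V q"
  using assms by (auto simp: cross_ln_def sandwich_add[OF assms] algebra_simps sum.distrib simp del: index_mult_mat(1))

lemma cross_ln_self:
  assumes "spectral_decomp d W V q"
  shows "cross_ln d W V q = - vN_entropy W"
  by (simp add: cross_ln_def spectral_decomp_diag[OF assms] vN_entropy_eq[OF assms])

text \<open>The overlaps |<u_i, v_j>|^2 are nonnegative and, by \<open>unitary_row_norm\<close>, sum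
  to 1 over \<open>j\<close>. This is what reduces trace inequalities to averages of scalar
  ones.\<close>

lemma cross_ln_eq:
  assumes "spectral_decomp d A U p" "V \<in> carrier_mat d d"
  shows "cross_ln d A V q = (\<Sum>i<d. \<Sum>j<d. p i * (cmod ((mat_adjoint U * V) $$ (i, j)))\<^sup>2 * ln (q j))"
proof -
  have "cross_ln d A V q = (\<Sum>j<d. \<Sum>i<d. p i * (cmod ((mat_adjoint U * V) $$ (i, j)))\<^sup>2 * ln (q j))"
    unfolding cross_ln_def
    by (intro sum.cong refl) (simp add: spectral_sandwich_index[OF assms] sum_distrib_right del: index_mult_mat(1))
  thus ?thesis by (subst sum.swap)
qed

text \<open>If v_j lies in the kernel of \<open>W\<close>, then 0 \<le> \<open>A\<close> \<le>
  \<open>W\<close> forces <v_j, A v_j> = 0. This is a sum of nonnegative terms, so each one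
  vanishes. Hence the value chosen for \<open>ln 0\<close> never matters in the cross terms.\<close>

lemma support_of_dominated:
  assumes A: "spectral_decomp d A U p" "psd_mat d A" and W: "spectral_decomp d W V q"
    and le: "psd_mat d (W - A)" and ij: "i < d" "j < d" and "q j = 0"
  shows "p i * (cmod ((mat_adjoint U * V) $$ (i, j)))\<^sup>2 = 0"
proof -
  note v = unitary_matD[OF spectral_decompD(1)[OF W]]
  have "0 \<le> Re ((mat_adjoint V * (W - A) * V) $$ (j, j))"
    using v ij by (intro psd_sandwich_index[OF le]) auto
  also have "\<dots> = - Re ((mat_adjoint V * A * V) $$ (j, j))"
    using ij v spectral_decompD(3)[OF A(1)] spectral_decompD(3)[OF W] \<open>q j = 0\<close>
    by (simp add: sandwich_minus spectral_decomp_diag[OF W] del: index_mult_mat(1))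
  also have "\<dots> = - (\<Sum>k<d. p k * (cmod ((mat_adjoint U * V) $$ (k, j)))\<^sup>2)"
    using v ij by (subst spectral_sandwich_index[OF A(1)]) auto
  finally have "(\<Sum>k<d. p k * (cmod ((mat_adjoint U * V) $$ (k, j)))\<^sup>2) \<le> 0" by simp
  moreover have nn: "0 \<le> p k * (cmod ((mat_adjoint U * V) $$ (k, j)))\<^sup>2" if "k < d" for k
    using spectral_psd_nonneg[OF A that] by simp
  ultimately have "(\<Sum>k<d. p k * (cmod ((mat_adjoint U * V) $$ (k, j)))\<^sup>2) = 0"
    by (intro antisym sum_nonneg) auto
  thus ?thesis using nn ij by (subst (asm) sum_nonneg_eq_0_iff) auto
qed

text \<open>With \<open>y = W\<^sup>-\<^sup>1 u\<^sub>i\<close>, the pairing of \<open>A \<le> W\<close> with \<open>y\<close> gives \<open>p\<^sub>i \<langle>u\<^sub>i, y\<rangle>\<^sup>2 \<le> \<langle>u\<^sub>i, y\<rangle>\<close>.\<close>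

lemma resolvent_bound:
  assumes A: "spectral_decomp d A U p" "psd_mat d A" and W: "spectral_decomp d W V q"
    and le: "psd_mat d (W - A)" and psdW: "psd_mat d W" and i: "i < d"
  shows "p i * (\<Sum>j<d. (cmod ((mat_adjoint U * V) $$ (i, j)))\<^sup>2 / q j) \<le> 1"
proof -
  note u = unitary_matD[OF spectral_decompD(1)[OF A(1)]] and v = unitary_matD[OF spectral_decompD(1)[OF W]]
  define x where "x = (\<Sum>j<d. (cmod ((mat_adjoint U * V) $$ (i, j)))\<^sup>2 / q j)"
  define C where "C = mat_adjoint U * V"
  \<comment> \<open>Column \<open>i\<close> of \<open>Y\<close> holds the coordinates of the vector
    y in the eigenbasis \<open>V\<close>, and column \<open>i\<close> of \<open>Z\<close> is y
    itself. Since \<open>1 / 0 = 0\<close>, the inverse of \<open>W\<close> is the pseudoinverse,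
    and q (1/q)^2 = 1/q also holds at q = 0.\<close>
  define Y where "Y = real_diag d (\<lambda>j. 1 / q j) * mat_adjoint C"
  define Z where "Z = V * Y"
  have C: "C \<in> carrier_mat d d" using u v by (auto simp: C_def)
  have Y: "Y \<in> carrier_mat d d" using C by (auto simp: Y_def)
  have Z: "Z \<in> carrier_mat d d" using v Y by (auto simp: Z_def)
  have Yi: "Y $$ (j, i) = cnj (C $$ (i, j)) / q j" if "j < d" for j
    using C that i unfolding Y_def
    by (subst real_diag_mult_left_index[of _ d d]) auto
  have q: "0 \<le> q j" if "j < d" for j using spectral_psd_nonneg[OF W psdW that] .
  have p: "0 \<le> p j" if "j < d" for j using spectral_psd_nonneg[OF A that] .
  have VZ: "mat_adjoint V * Z = Y"
    using v Y unfolding Z_def by (subst assoc_mult_mat[symmetric, of _ d d _ d _ d]) auto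
  have UZ: "mat_adjoint U * Z = C * Y"
    using u v Y unfolding Z_def C_def by (subst assoc_mult_mat[of _ d d _ d _ d]) auto
  have "Re ((mat_adjoint Z * W * Z) $$ (i, i)) = (\<Sum>k<d. q k * (cmod (Y $$ (k, i)))\<^sup>2)"
    using spectral_sandwich_index[OF W Z i] by (simp add: VZ)
  also have "\<dots> = x" unfolding x_def C_def[symmetric]
    by (intro sum.cong refl) (auto simp: Yi norm_divide power2_eq_square)
  finally have WZ: "Re ((mat_adjoint Z * W * Z) $$ (i, i)) = x" .
  have CY: "(C * Y) $$ (i, i) = complex_of_real x"
  proof -
    have "(C * Y) $$ (i, i) = (\<Sum>j<d. C $$ (i, j) * Y $$ (j, i))"
      using C Y i by (intro mult_mat_index_sum) auto
    also have "\<dots> = complex_of_real x" unfolding x_def C_def[symmetric] of_real_sum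
      by (intro sum.cong refl) (simp add: Yi complex_norm_square del: of_real_power)
    finally show ?thesis .
  qed
  \<comment> \<open>Only the term of u_i is kept from the expansion of <y, A y>; its overlap with y
    is \<open>x\<close>, and <y, W y> is \<open>x\<close> too.\<close>
  have "p i * x\<^sup>2 = p i * (cmod ((C * Y) $$ (i, i)))\<^sup>2" by (simp add: CY)
  also have "\<dots> \<le> (\<Sum>k<d. p k * (cmod ((C * Y) $$ (k, i)))\<^sup>2)"
    using i p by (intro member_le_sum[of i "{..<d}" "\<lambda>k. p k * (cmod ((C * Y) $$ (k, i)))\<^sup>2"]) auto
  also have "\<dots> = Re ((mat_adjoint Z * A * Z) $$ (i, i))"
    using spectral_sandwich_index[OF A(1) Z i] by (simp add: UZ)
  also have "\<dots> \<le> Re ((mat_adjoint Z * W * Z) $$ (i, i))"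
    using psd_sandwich_index[OF le Z i] Z i spectral_decompD(3)[OF A(1)] spectral_decompD(3)[OF W]
    by (simp add: sandwich_minus del: index_mult_mat(1))
  finally have "p i * x\<^sup>2 \<le> x" by (simp only: WZ)
  moreover have "0 \<le> x" unfolding x_def by (intro sum_nonneg) (auto simp: q)
  ultimately have "p i * x \<le> 1" by (cases "x = 0") (auto simp: power2_eq_square mult.assoc[symmetric])
  thus ?thesis by (simp add: x_def)
qed

text \<open>For fixed \<open>i\<close>, average 1 - t \<le> - ln t at t = \<open>p i / q j\<close>
  over \<open>j\<close> with the overlap weights. The average of the left side is nonnegative by
  \<open>resolvent_bound\<close>, so ln p_i is at most the average of ln q_j. Multiplying by p_i and
  summing gives Tr (A ln A) \<le> Tr (A ln W).\<close>

lemma entropy_le_cross_of_dominated: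
  assumes A: "spectral_decomp d A U p" "psd_mat d A" and W: "spectral_decomp d W V q"
    and le: "psd_mat d (W - A)" and psdW: "psd_mat d W"
  shows "- vN_entropy A \<le> cross_ln d A V q"
proof -
  note u = unitary_matD[OF spectral_decompD(1)[OF A(1)]] and v = unitary_matD[OF spectral_decompD(1)[OF W]]
  have q: "0 \<le> q j" if "j < d" for j using spectral_psd_nonneg[OF W psdW that] .
  have UV: "unitary_mat d (mat_adjoint U * V)"
    using spectral_decompD(1)[OF A(1)] spectral_decompD(1)[OF W] by (intro unitary_mat_mult unitary_mat_adjoint)
  define c where "c i j = (cmod ((mat_adjoint U * V) $$ (i, j)))\<^sup>2" for i j
  have "p i * ln (p i) \<le> (\<Sum>j<d. p i * c i j * ln (q j))" if i: "i < d" for i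
  proof (cases "p i = 0")
    case False
    hence p: "0 < p i" using spectral_psd_nonneg[OF A i] by simp
    have "0 \<le> 1 - p i * (\<Sum>j<d. c i j / q j)"
      using resolvent_bound[OF A W le psdW i] by (simp add: c_def)
    also have "\<dots> = (\<Sum>j<d. c i j * (1 - p i / q j))"
      using unitary_row_norm[OF UV i] by (simp add: c_def[symmetric] algebra_simps sum_subtractf sum_distrib_left)
    also have "\<dots> \<le> (\<Sum>j<d. c i j * (ln (q j) - ln (p i)))"
    proof (rule sum_mono)
      fix j assume "j \<in> {..<d}"
      hence j: "j < d" by simp
      show "c i j * (1 - p i / q j) \<le> c i j * (ln (q j) - ln (p i))"
      proof (cases "q j = 0")
        \<comment> \<open>Here ln t \<le> t - 1 is not applicable, but the weight itself vanishes
          because p_i is nonzero.\<close>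
        case True
        hence "c i j = 0" using support_of_dominated[OF A W le i j] False by (simp add: c_def)
        thus ?thesis by simp
      next
        case False
        hence "0 < q j" using q[OF j] by simp
        hence "ln (p i / q j) \<le> p i / q j - 1" using p by (intro ln_le_minus_one) simp
        hence "1 - p i / q j \<le> ln (q j) - ln (p i)" using p \<open>0 < q j\<close> by (simp add: ln_div)
        thus ?thesis by (intro mult_left_mono) (auto simp: c_def)
      qed
    qed
    also have "\<dots> = (\<Sum>j<d. c i j * ln (q j)) - ln (p i)"
      using unitary_row_norm[OF UV i]
      by (simp add: c_def[symmetric] algebra_simps sum_subtractf sum_distrib_left[symmetric])
    finally have "p i * ln (p i) \<le> p i * (\<Sum>j<d. c i j * ln (q j))" using p by simp
    thus ?thesis by (simp add: sum_distrib_left mult.assoc)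
  qed simp
  hence "(\<Sum>i<d. p i * ln (p i)) \<le> (\<Sum>i<d. \<Sum>j<d. p i * c i j * ln (q j))"
    by (intro sum_mono) auto
  thus ?thesis
    by (simp add: vN_entropy_eq[OF A(1)] cross_ln_eq[OF A(1) v(1)] c_def)
qed

section \<open>Monotonicity of relative entropy under a binary measurement\<close>

definition projection_mat :: "nat \<Rightarrow> complex mat \<Rightarrow> bool" where
  "projection_mat d Q \<longleftrightarrow> Q \<in> carrier_mat d d \<and> hermitian_mat Q \<and> Q * Q = Q"

lemma projection_matD:
  assumes "projection_mat d Q"
  shows "Q \<in> carrier_mat d d" "mat_adjoint Q = Q" "Q * Q = Q"
  using assms by (auto simp: projection_mat_def hermitian_mat_def)

text \<open>Idempotence and cyclicity turn the trace into that of
  \<open>mat_adjoint Q * M * Q\<close>, whose diagonal entries are values of the quadratic form of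
  \<open>M\<close>.\<close>

lemma psd_trace_projection_nonneg:
  assumes "psd_mat d M" "projection_mat d Q"
  shows "0 \<le> Re (mat_trace (M * Q))"
proof -
  note m = psd_matD[OF assms(1)] and q = projection_matD[OF assms(2)]
  have "mat_trace (M * Q) = mat_trace ((M * Q) * Q)"
    using m q by (simp add: assoc_mult_mat[of _ d d _ d _ d])
  also have "\<dots> = mat_trace (mat_adjoint Q * (M * Q))"
    using m q by (subst mat_trace_mult_comm[of "M * Q" d d]) auto
  also have "mat_adjoint Q * (M * Q) = mat_adjoint Q * M * Q"
    using m q by (intro assoc_mult_mat[symmetric]) auto
  finally have "Re (mat_trace (M * Q)) = (\<Sum>i<d. Re ((mat_adjoint Q * M * Q) $$ (i, i)))"
    using q(1,2) by (simp add: mat_trace_def del: index_mult_mat(1))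
  also have "\<dots> \<ge> 0" using psd_sandwich_index[OF assms(1) q(1)] by (intro sum_nonneg) auto
  finally show ?thesis .
qed

lemma projection_mat_compl:
  assumes "projection_mat d Q"
  shows "projection_mat d (1\<^sub>m d - Q)"
proof -
  note q = projection_matD[OF assms]
  have "mat_adjoint (1\<^sub>m d - Q) = 1\<^sub>m d - Q"
  proof (rule eq_matI)
    fix i j assume "i < dim_row (1\<^sub>m d - Q)" "j < dim_col (1\<^sub>m d - Q)"
    hence "i < d" "j < d" using q by auto
    thus "mat_adjoint (1\<^sub>m d - Q) $$ (i, j) = (1\<^sub>m d - Q) $$ (i, j)"
      using q(1) hermitian_mat_index[of Q d j i] assms
      by (auto simp: projection_mat_def)
  qed (use q in auto)
  moreover have "(1\<^sub>m d - Q) * (1\<^sub>m d - Q) = 1\<^sub>m d - Q"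
  proof -
    have "(1\<^sub>m d - Q) * (1\<^sub>m d - Q) = (1\<^sub>m d - Q) - (Q - Q)"
      using q(1,3) by (simp add: minus_mult_distrib_mat[of _ d d _ _ d] mult_minus_distrib_mat[of _ d d _ d] minus_carrier_mat)
    also have "\<dots> = 1\<^sub>m d - Q" using q(1) by (intro eq_matI) auto
    finally show ?thesis .
  qed
  ultimately show ?thesis using q by (auto simp: projection_mat_def hermitian_mat_def)
qed

lemma trace_mult_compl:
  fixes M Q :: "complex mat"
  assumes "M \<in> carrier_mat d d" "Q \<in> carrier_mat d d"
  shows "mat_trace (M * (1\<^sub>m d - Q)) = mat_trace M - mat_trace (M * Q)"
  using assms by (simp add: mult_minus_distrib_mat[of _ d d _ d] minus_carrier_mat mat_trace_minus[of _ d] mult_carrier)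

text \<open>The observables that can be read off from the measurement {Q, 1 - Q}: value
  \<open>x\<close> on the range of \<open>Q\<close> and \<open>y\<close> on its complement. As trial
  operators they see \<open>A\<close> and \<open>W\<close> only through the weights of the two
  outcomes.\<close>

definition two_valued :: "nat \<Rightarrow> complex mat \<Rightarrow> real \<Rightarrow> real \<Rightarrow> complex mat" where
  "two_valued d Q x y = complex_of_real x \<cdot>\<^sub>m Q + complex_of_real y \<cdot>\<^sub>m (1\<^sub>m d - Q)"

lemma two_valued:
  assumes "projection_mat d Q"
  shows "two_valued d Q x y \<in> carrier_mat d d"
    and "mat_adjoint (two_valued d Q x y) = two_valued d Q x y"
    and "two_valued d Q x y * two_valued d Q x y = two_valued d Q (x\<^sup>2) (y\<^sup>2)"
    and "M \<in> carrier_mat d d \<Longrightarrow> Re (mat_trace (M * two_valued d Q x y))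
      = x * Re (mat_trace (M * Q)) + y * Re (mat_trace M - mat_trace (M * Q))"
proof -
  note q = projection_matD[OF assms] and q' = projection_matD[OF projection_mat_compl[OF assms]]
  let ?R = "1\<^sub>m d - Q"
  show c: "two_valued d Q x y \<in> carrier_mat d d" using q by (auto simp: two_valued_def)
  show "mat_adjoint (two_valued d Q x y) = two_valued d Q x y"
  proof (rule eq_matI)
    fix i j assume "i < dim_row (two_valued d Q x y)" "j < dim_col (two_valued d Q x y)"
    hence ij: "i < d" "j < d" using c by auto
    have "Q $$ (i, j) = cnj (Q $$ (j, i))" using hermitian_mat_index[of Q d i j] ij assms
      by (auto simp: projection_mat_def)
    thus "mat_adjoint (two_valued d Q x y) $$ (i, j) = two_valued d Q x y $$ (i, j)"
      using q(1) ij by (auto simp: two_valued_def)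
  qed (use c in auto)
  have z: "Q * ?R = 0\<^sub>m d d" "?R * Q = 0\<^sub>m d d"
    using q(1,3) by (simp_all add: minus_mult_distrib_mat[of _ d d _ _ d] mult_minus_distrib_mat[of _ d d _ d] minus_carrier_mat)
  let ?a = "complex_of_real x" and ?b = "complex_of_real y"
  have "two_valued d Q x y * two_valued d Q x y
      = (?a \<cdot>\<^sub>m Q) * (?a \<cdot>\<^sub>m Q) + (?b \<cdot>\<^sub>m ?R) * (?a \<cdot>\<^sub>m Q) + ((?a \<cdot>\<^sub>m Q) * (?b \<cdot>\<^sub>m ?R) + (?b \<cdot>\<^sub>m ?R) * (?b \<cdot>\<^sub>m ?R))"
    using q(1) q'(1) unfolding two_valued_def
    by (simp add: add_mult_distrib_mat[of _ d d _ _ d] mult_add_distrib_mat[of _ d d _ d] mult_carrier)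
  also have "\<dots> = two_valued d Q (x\<^sup>2) (y\<^sup>2)"
  proof -
    have prod: "(k \<cdot>\<^sub>m S) * (l \<cdot>\<^sub>m T) = (k * l) \<cdot>\<^sub>m (S * T)"
      if "S \<in> carrier_mat d d" "T \<in> carrier_mat d d" for k l and S T :: "complex mat"
      using that by (simp add: mult_smult_assoc_mat[of _ d d _ d] mult_smult_distrib[of _ d d _ d])
        (intro eq_matI, auto)
    show ?thesis unfolding two_valued_def
      by (simp only: prod[OF q(1) q(1)] prod[OF q(1) q'(1)] prod[OF q'(1) q(1)] prod[OF q'(1) q'(1)]
          q(3) q'(3) z power2_eq_square of_real_mult)
        (use q(1) q'(1) in \<open>intro eq_matI, auto\<close>)
  qed
  finally show "two_valued d Q x y * two_valued d Q x y = two_valued d Q (x\<^sup>2) (y\<^sup>2)" .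
  show "Re (mat_trace (M * two_valued d Q x y))
      = x * Re (mat_trace (M * Q)) + y * Re (mat_trace M - mat_trace (M * Q))"
    if M: "M \<in> carrier_mat d d"
  proof -
    have "M * two_valued d Q x y = ?a \<cdot>\<^sub>m (M * Q) + ?b \<cdot>\<^sub>m (M * ?R)"
      using q(1) q'(1) M unfolding two_valued_def
      by (simp add: mult_add_distrib_mat[of _ d d _ d] minus_carrier_mat mult_smult_distrib[of _ d d _ d])
    thus ?thesis using q(1) q'(1) M
      by (simp add: mat_trace_add[of _ d] mat_trace_smult[of _ d] mult_carrier trace_mult_compl)
  qed
qed

text \<open>Completing the square in each entry of \<open>U\<^sup>* X V\<close>: a quadratic functional of \<open>X\<close> is bounded by its
  unrestricted maximum, which is the quantum resolvent term.\<close>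

lemma quadratic_trace_bound:
  assumes A: "spectral_decomp d A U p" "psd_mat d A" and W: "spectral_decomp d W V q"
    and psdW: "psd_mat d W" and X: "X \<in> carrier_mat d d" "mat_adjoint X = X"
    and r: "0 < r" "r < 1"
  shows "2 * Re (mat_trace (A * X)) - r * Re (mat_trace (A * (X * X))) - (1 - r) * Re (mat_trace (W * (X * X)))
    \<le> (\<Sum>i<d. \<Sum>j<d. (p i)\<^sup>2 * (cmod ((mat_adjoint U * V) $$ (i, j)))\<^sup>2 / (r * p i + (1 - r) * q j))"
proof -
  note u = unitary_matD[OF spectral_decompD(1)[OF A(1)]] and v = unitary_matD[OF spectral_decompD(1)[OF W]]
  define C where "C = mat_adjoint U * V"
  \<comment> \<open>Entry (i, j) is <u_i, X v_j>. In these mixed coordinates all three traces become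
    sums over the same pairs, so the maximisation decouples entry by entry.\<close>
  define Y where "Y = mat_adjoint U * X * V"
  have C: "C \<in> carrier_mat d d" using u v by (auto simp: C_def)
  have Y: "Y \<in> carrier_mat d d" using u v X by (auto simp: Y_def)
  have Ca: "mat_adjoint C = mat_adjoint V * U"
    using mat_adjoint_mult[OF u(2) v(1)] by (simp add: C_def)
  have Ya: "mat_adjoint Y = mat_adjoint V * X * U"
    using u v X by (simp add: Y_def mat_adjoint_mult[of _ d d _ d] mult_carrier assoc_mult_mat[of _ d d _ d _ d])
  have assoc: "S * T * R = S * (T * R)"
    if "S \<in> carrier_mat d d" "T \<in> carrier_mat d d" "R \<in> carrier_mat d d" for S T R :: "complex mat"
    using that by (rule assoc_mult_mat)
  have cancel: "V * (mat_adjoint V * T) = T" "U * (mat_adjoint U * T) = T" if "T \<in> carrier_mat d d" for T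
    using that u v by (simp_all flip: assoc)
  have YC: "Y * mat_adjoint C = mat_adjoint U * X * U"
    using u(1,2) v(1,2) X unfolding Ca unfolding Y_def by (simp add: assoc cancel mult_carrier)
  have YY: "Y * mat_adjoint Y = mat_adjoint U * (X * X) * U"
    using u(1,2) v(1,2) X unfolding Ya unfolding Y_def by (simp add: assoc cancel mult_carrier)
  have YY': "mat_adjoint Y * Y = mat_adjoint V * (X * X) * V"
    using u(1,2) v(1,2) X unfolding Ya unfolding Y_def by (simp add: assoc cancel mult_carrier)
  have t1: "Re (mat_trace (A * X)) = (\<Sum>i<d. \<Sum>j<d. p i * Re (Y $$ (i, j) * cnj (C $$ (i, j))))"
  proof -
    have "Re ((Y * mat_adjoint C) $$ (i, i)) = (\<Sum>j<d. Re (Y $$ (i, j) * cnj (C $$ (i, j))))" if "i < d" for i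
      using that C Y by (subst mult_mat_index_sum[of _ d d _ d]) (auto simp del: times_complex.sel complex_cnj_mult)
    thus ?thesis
      unfolding spectral_trace_mult[OF A(1) X(1)] YC[symmetric]
      by (simp add: sum_distrib_left del: times_complex.sel index_mult_mat(1))
  qed
  have t2: "Re (mat_trace (A * (X * X))) = (\<Sum>i<d. \<Sum>j<d. p i * (cmod (Y $$ (i, j)))\<^sup>2)"
    unfolding spectral_trace_mult[OF A(1) mult_carrier[OF X(1) X(1)]] YY[symmetric]
    by (intro sum.cong refl)
      (simp add: mult_adjoint_index[OF Y] sum_distrib_left del: index_mult_mat(1) of_real_power)
  have t3: "Re (mat_trace (W * (X * X))) = (\<Sum>i<d. \<Sum>j<d. q j * (cmod (Y $$ (i, j)))\<^sup>2)"
  proof -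
    have "Re ((mat_adjoint Y * Y) $$ (j, j)) = (\<Sum>i<d. (cmod (Y $$ (i, j)))\<^sup>2)" if "j < d" for j
    proof -
      have "(mat_adjoint Y * Y) $$ (j, j) = (\<Sum>i<d. complex_of_real ((cmod (Y $$ (i, j)))\<^sup>2))"
        using that Y mult_adjoint_index[OF adjoint_carrier[OF Y] that] by simp
      thus ?thesis by (simp del: of_real_power index_mult_mat(1))
    qed
    hence "Re (mat_trace (W * (X * X))) = (\<Sum>j<d. \<Sum>i<d. q j * (cmod (Y $$ (i, j)))\<^sup>2)"
      unfolding spectral_trace_mult[OF W mult_carrier[OF X(1) X(1)]] YY'[symmetric]
      by (simp add: sum_distrib_left del: index_mult_mat(1))
    thus ?thesis by (subst sum.swap)
  qed
  have "2 * Re (mat_trace (A * X)) - r * Re (mat_trace (A * (X * X))) - (1 - r) * Re (mat_trace (W * (X * X)))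
      = (\<Sum>i<d. \<Sum>j<d. 2 * (p i * Re (Y $$ (i, j) * cnj (C $$ (i, j))))
          - (r * p i + (1 - r) * q j) * (cmod (Y $$ (i, j)))\<^sup>2)"
    unfolding t1 t2 t3
    by (simp add: sum_distrib_left sum_subtractf sum.distrib algebra_simps del: times_complex.sel)
  also have "\<dots> \<le> (\<Sum>i<d. \<Sum>j<d. (p i)\<^sup>2 * (cmod (C $$ (i, j)))\<^sup>2 / (r * p i + (1 - r) * q j))"
  proof (intro sum_mono)
    fix i j assume "i \<in> {..<d}" "j \<in> {..<d}"
    hence ij: "i < d" "j < d" by auto
    have pq: "0 \<le> p i" "0 \<le> q j" using spectral_psd_nonneg[OF A ij(1)] spectral_psd_nonneg[OF W psdW ij(2)] .
    define m where "m = r * p i + (1 - r) * q j"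
    define y where "y = Y $$ (i, j)"
    define c where "c = C $$ (i, j)"
    have "0 \<le> m" using pq r by (simp add: m_def)
    show "2 * (p i * Re (Y $$ (i, j) * cnj (C $$ (i, j)))) - (r * p i + (1 - r) * q j) * (cmod (Y $$ (i, j)))\<^sup>2
        \<le> (p i)\<^sup>2 * (cmod (C $$ (i, j)))\<^sup>2 / (r * p i + (1 - r) * q j)"
      unfolding m_def[symmetric] y_def[symmetric] c_def[symmetric]
    proof (cases "m = 0")
      case True
      \<comment> \<open>Since r > 0, a vanishing denominator forces p_i = 0; the left side is then 0
        and the right side is a quotient by zero, hence also 0.\<close>
      hence "p i = 0" using pq r by (simp add: m_def add_nonneg_eq_0_iff)
      thus "2 * (p i * Re (y * cnj c)) - m * (cmod y)\<^sup>2 \<le> (p i)\<^sup>2 * (cmod c)\<^sup>2 / m" using True by simp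
    next
      case False
      hence m: "0 < m" using \<open>0 \<le> m\<close> by simp
      \<comment> \<open>This is |m y - p_i c|^2 \<ge> 0, the completed square multiplied by
        m.\<close>
      have "0 \<le> (m * Re y - p i * Re c)\<^sup>2 + (m * Im y - p i * Im c)\<^sup>2" by simp
      also have "\<dots> = m * (m * (cmod y)\<^sup>2) - m * (2 * (p i * Re (y * cnj c))) + (p i)\<^sup>2 * (cmod c)\<^sup>2"
        unfolding cmod_power2 by (simp add: power2_eq_square algebra_simps)
      finally have "(2 * (p i * Re (y * cnj c)) - m * (cmod y)\<^sup>2) * m \<le> (p i)\<^sup>2 * (cmod c)\<^sup>2"
        by (simp add: algebra_simps)
      thus "2 * (p i * Re (y * cnj c)) - m * (cmod y)\<^sup>2 \<le> (p i)\<^sup>2 * (cmod c)\<^sup>2 / m"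
        using m by (simp add: pos_le_divide_eq)
    qed
  qed
  finally show ?thesis by (simp add: C_def)
qed

text \<open>On two-valued trial operators the functional splits into 2 a x - m x^2 for each outcome,
  with m = r a + (1 - r) w. Its maximiser x = a / m has value a^2 / m. This restricted maximum
  cannot exceed the bound valid for all self-adjoint operators.\<close>

lemma resolvent_ge_classical:
  assumes A: "spectral_decomp d A U p" "psd_mat d A" and W: "spectral_decomp d W V q"
    and psdW: "psd_mat d W" and Q: "projection_mat d Q" and r: "0 < r" "r < 1"
  defines "a1 \<equiv> Re (mat_trace (A * Q))" and "a2 \<equiv> Re (mat_trace A - mat_trace (A * Q))"
    and "w1 \<equiv> Re (mat_trace (W * Q))" and "w2 \<equiv> Re (mat_trace W - mat_trace (W * Q))"
  shows "a1\<^sup>2 / (r * a1 + (1 - r) * w1) + a2\<^sup>2 / (r * a2 + (1 - r) * w2)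
    \<le> (\<Sum>i<d. \<Sum>j<d. (p i)\<^sup>2 * (cmod ((mat_adjoint U * V) $$ (i, j)))\<^sup>2 / (r * p i + (1 - r) * q j))"
proof -
  let ?x = "a1 / (r * a1 + (1 - r) * w1)" and ?y = "a2 / (r * a2 + (1 - r) * w2)"
  let ?X = "two_valued d Q ?x ?y"
  note t = two_valued[OF Q] and c = spectral_decompD(3)[OF A(1)] spectral_decompD(3)[OF W]
  have sq: "a\<^sup>2 / m = 2 * (a / m * a) - m * ((a / m)\<^sup>2)" for a m :: real
    by (cases "m = 0") (auto simp: power2_eq_square field_simps)
  have "a1\<^sup>2 / (r * a1 + (1 - r) * w1) + a2\<^sup>2 / (r * a2 + (1 - r) * w2)
      = 2 * (?x * a1 + ?y * a2) - r * (?x\<^sup>2 * a1 + ?y\<^sup>2 * a2) - (1 - r) * (?x\<^sup>2 * w1 + ?y\<^sup>2 * w2)"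
    unfolding sq[of a1] sq[of a2] by (simp only: algebra_simps)
  also have "\<dots> = 2 * Re (mat_trace (A * ?X)) - r * Re (mat_trace (A * (?X * ?X)))
      - (1 - r) * Re (mat_trace (W * (?X * ?X)))"
    unfolding t(3) t(4)[OF c(1)] t(4)[OF c(2)] by (simp only: a1_def a2_def w1_def w2_def)
  also have "\<dots> \<le> (\<Sum>i<d. \<Sum>j<d. (p i)\<^sup>2 * (cmod ((mat_adjoint U * V) $$ (i, j)))\<^sup>2 / (r * p i + (1 - r) * q j))"
    by (rule quadratic_trace_bound[OF A W psdW t(1,2) r])
  finally show ?thesis .
qed

text \<open>Positivity is demanded only for nonzero weight \<open>e\<close>, because otherwise the
  function is constantly 0. This gives differentiability at the endpoints 0 and 1 even when
  \<open>A\<close> or \<open>W\<close> is singular.\<close>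

lemma has_derivative_weighted_ln:
  fixes e a b r :: real
  assumes "e \<noteq> 0 \<Longrightarrow> 0 < a \<and> 0 < b" "0 \<le> r" "r \<le> 1"
  shows "((\<lambda>r. e * ln (r * a + (1 - r) * b)) has_real_derivative e * (a - b) / (r * a + (1 - r) * b)) (at r)"
proof (cases "e = 0")
  case False
  hence "0 < a" "0 < b" using assms by auto
  hence "0 < r * a + (1 - r) * b"
    using assms(2,3) by (cases "r = 0") (auto intro!: add_pos_nonneg)
  thus ?thesis by (auto intro!: derivative_eq_intros simp: field_simps)
qed simp

text \<open>The identity (1 - r) (a - b) = a - (r a + (1 - r) b) splits the derivative of the
  logarithm into a resolvent term and a term free of \<open>r\<close>.\<close>

lemma weighted_ln_derivative_eq:
  fixes c a b r :: real
  assumes "c * a \<noteq> 0 \<Longrightarrow> 0 < a \<and> 0 < b" "0 \<le> r" "r \<le> 1"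
  shows "(1 - r) * (a * c * (a - b) / (r * a + (1 - r) * b)) = a\<^sup>2 * c / (r * a + (1 - r) * b) - a * c"
proof (cases "c * a = 0")
  case False
  hence "0 < a" "0 < b" using assms by auto
  hence "0 < r * a + (1 - r) * b"
    using assms(2,3) by (cases "r = 0") (auto intro!: add_pos_nonneg)
  thus ?thesis by (simp add: field_simps power2_eq_square)
qed auto

text \<open>The interpolation \<open>H\<close> between \<open>ln W\<close> (at \<open>0\<close>) and \<open>ln A\<close> (at \<open>1\<close>), minus its measured
  counterpart, is nondecreasing since its derivative is a difference of resolvent terms.\<close>

lemma relative_entropy_ge_measured:
  assumes A: "spectral_decomp d A U p" "psd_mat d A" and W: "spectral_decomp d W V q"
    and psdW: "psd_mat d W" and le: "psd_mat d (W - A)" and Q: "projection_mat d Q"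
  defines "a1 \<equiv> Re (mat_trace (A * Q))" and "a2 \<equiv> Re (mat_trace A - mat_trace (A * Q))"
    and "w1 \<equiv> Re (mat_trace (W * Q))" and "w2 \<equiv> Re (mat_trace W - mat_trace (W * Q))"
  shows "(a1 * ln a1 - a1 * ln w1) + (a2 * ln a2 - a2 * ln w2) \<le> - vN_entropy A - cross_ln d A V q"
proof -
  note c = spectral_decompD(3)[OF A(1)] spectral_decompD(3)[OF W]
  note v = unitary_matD[OF spectral_decompD(1)[OF W]] and Qc = projection_matD(1)[OF Q]
  have p: "0 \<le> p i" if "i < d" for i using spectral_psd_nonneg[OF A that] .
  have q: "0 \<le> q j" if "j < d" for j using spectral_psd_nonneg[OF W psdW that] .
  have UV: "unitary_mat d (mat_adjoint U * V)"
    using spectral_decompD(1)[OF A(1)] spectral_decompD(1)[OF W] by (intro unitary_mat_mult unitary_mat_adjoint)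
  define k where "k i j = (cmod ((mat_adjoint U * V) $$ (i, j)))\<^sup>2" for i j
  have supp: "0 < p i \<and> 0 < q j" if "k i j * p i \<noteq> 0" "i < d" "j < d" for i j
    using that p[of i] q[of j] support_of_dominated[OF A W le that(2,3)] by (force simp: k_def less_le)
  \<comment> \<open>The total weight on the quantum side equals that of the two outcomes, both being
    Tr A, so the terms free of \<open>r\<close> cancel when derivatives are compared.\<close>
  have kp: "(\<Sum>i<d. \<Sum>j<d. p i * k i j) = a1 + a2"
  proof -
    have "(\<Sum>i<d. \<Sum>j<d. p i * k i j) = (\<Sum>i<d. p i)"
      using unitary_row_norm[OF UV] by (simp add: k_def sum_distrib_left[symmetric])
    thus ?thesis using spectral_trace[OF A(1)] by (simp add: a1_def a2_def)
  qed
  have tr: "0 \<le> Re (mat_trace (M * Q))" "0 \<le> Re (mat_trace M - mat_trace (M * Q))" if "psd_mat d M" for M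
    using psd_trace_projection_nonneg[OF that Q] psd_trace_projection_nonneg[OF that projection_mat_compl[OF Q]]
      psd_matD(1)[OF that] Qc by (simp_all add: trace_mult_compl)
  \<comment> \<open>Testing the positive operator \<open>W - A\<close> with Q and 1 - Q shows that
    domination survives the measurement; hence a nonzero outcome weight of \<open>A\<close> comes
    with a positive one of \<open>W\<close>.\<close>
  have aw: "0 \<le> a1" "a1 \<le> w1" "0 \<le> a2" "a2 \<le> w2"
    using tr[OF A(2)] tr[OF le] c Qc unfolding a1_def a2_def w1_def w2_def
    by (simp_all add: minus_mult_distrib_mat[of _ d d _ _ d] minus_carrier_mat mat_trace_minus[of _ d] mult_carrier)
  define H where "H r = (\<Sum>i<d. \<Sum>j<d. p i * k i j * ln (r * p i + (1 - r) * q j))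
      - (a1 * ln (r * a1 + (1 - r) * w1) + a2 * ln (r * a2 + (1 - r) * w2))" for r
  define H' where "H' r = (\<Sum>i<d. \<Sum>j<d. p i * k i j * (p i - q j) / (r * p i + (1 - r) * q j))
      - (a1 * (a1 - w1) / (r * a1 + (1 - r) * w1) + a2 * (a2 - w2) / (r * a2 + (1 - r) * w2))" for r
  have deriv: "(H has_real_derivative H' r) (at r)" if r: "0 \<le> r" "r \<le> 1" for r
    unfolding H_def H'_def
    using aw supp by (intro DERIV_diff DERIV_add DERIV_sum has_derivative_weighted_ln r) (auto simp: mult.commute)
  have nonneg: "0 \<le> H' r" if r: "0 < r" "r < 1" for r
  proof -
    have "0 \<le> (\<Sum>i<d. \<Sum>j<d. (p i)\<^sup>2 * k i j / (r * p i + (1 - r) * q j))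
        - (a1\<^sup>2 / (r * a1 + (1 - r) * w1) + a2\<^sup>2 / (r * a2 + (1 - r) * w2))"
      using resolvent_ge_classical[OF A W psdW Q r] by (simp add: k_def a1_def a2_def w1_def w2_def)
    also have "\<dots> = (\<Sum>i<d. \<Sum>j<d. (p i)\<^sup>2 * k i j / (r * p i + (1 - r) * q j) - p i * k i j)
        - ((a1\<^sup>2 * 1 / (r * a1 + (1 - r) * w1) - a1 * 1) + (a2\<^sup>2 * 1 / (r * a2 + (1 - r) * w2) - a2 * 1))"
      using kp by (simp add: sum_subtractf)
    also have "(\<Sum>i<d. \<Sum>j<d. (p i)\<^sup>2 * k i j / (r * p i + (1 - r) * q j) - p i * k i j)
        = (\<Sum>i<d. \<Sum>j<d. (1 - r) * (p i * k i j * (p i - q j) / (r * p i + (1 - r) * q j)))"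
      using supp r by (intro sum.cong refl weighted_ln_derivative_eq[symmetric]) auto
    also have "a1\<^sup>2 * 1 / (r * a1 + (1 - r) * w1) - a1 * 1 = (1 - r) * (a1 * 1 * (a1 - w1) / (r * a1 + (1 - r) * w1))"
      using aw r by (intro weighted_ln_derivative_eq[symmetric]) auto
    also have "a2\<^sup>2 * 1 / (r * a2 + (1 - r) * w2) - a2 * 1 = (1 - r) * (a2 * 1 * (a2 - w2) / (r * a2 + (1 - r) * w2))"
      using aw r by (intro weighted_ln_derivative_eq[symmetric]) auto
    finally have "0 \<le> (1 - r) * H' r"
      by (simp add: H'_def sum_distrib_left right_diff_distrib distrib_left)
    thus ?thesis using r by (simp add: zero_le_mult_iff)
  qed
  \<comment> \<open>The sign of \<open>H'\<close> comes from an inequality multiplied by 1 - r, so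
    it is known only inside the interval; the mean value theorem asks for no more.\<close>
  obtain z where "0 < z" "z < 1" "H 1 - H 0 = (1 - 0) * H' z"
    using MVT2[of 0 1 H H'] deriv by auto
  hence "H 0 \<le> H 1" using nonneg[of z] by simp
  moreover have "H 0 = cross_ln d A V q - (a1 * ln w1 + a2 * ln w2)"
    by (simp add: H_def cross_ln_eq[OF A(1) v(1)] k_def)
  moreover have "H 1 = - vN_entropy A - (a1 * ln a1 + a2 * ln a2)"
    using unitary_row_norm[OF UV]
    by (simp add: H_def vN_entropy_eq[OF A(1)] k_def sum_distrib_left[symmetric] sum_distrib_right[symmetric] mult.assoc mult.commute[of _ "ln _"])
  ultimately show ?thesis by simp
qed

section \<open>The entropy bound\<close>

lemma hermitian_add:
  assumes "hermitian_mat A" "hermitian_mat B" "A \<in> carrier_mat d d" "B \<in> carrier_mat d d"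
  shows "hermitian_mat (A + B)"
  unfolding hermitian_mat_def
  using assms(3,4) hermitian_mat_index[OF assms(1,3), symmetric] hermitian_mat_index[OF assms(2,4), symmetric]
  by (intro eq_matI) auto

lemma psd_mat_add:
  assumes "psd_mat d A" "psd_mat d B"
  shows "psd_mat d (A + B)"
proof -
  note a = psd_matD[OF assms(1)] and b = psd_matD[OF assms(2)]
  have "0 \<le> Re (((A + B) *\<^sub>v v) \<bullet>c v)" if v: "v \<in> carrier_vec d" for v
  proof -
    have "((A + B) *\<^sub>v v) \<bullet>c v = (A *\<^sub>v v) \<bullet>c v + (B *\<^sub>v v) \<bullet>c v"
      using a(1) b(1) v by (simp add: add_mult_distrib_mat_vec[of _ d d] add_scalar_prod_distrib[of _ d])
    thus ?thesis using assms v by (simp add: psd_mat_def)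
  qed
  thus ?thesis using a b hermitian_add[OF a(2) b(2) a(1) b(1)] by (simp add: psd_mat_def)
qed

lemma psd_mat_smult:
  assumes "psd_mat d A" "0 \<le> c"
  shows "psd_mat d (complex_of_real c \<cdot>\<^sub>m A)"
proof -
  note a = psd_matD[OF assms(1)]
  have "0 \<le> Re (((complex_of_real c \<cdot>\<^sub>m A) *\<^sub>v v) \<bullet>c v)" if v: "v \<in> carrier_vec d" for v
  proof -
    have "(complex_of_real c \<cdot>\<^sub>m A) *\<^sub>v v = complex_of_real c \<cdot>\<^sub>v (A *\<^sub>v v)"
      using a(1) v by (intro eq_vecI) (auto simp: scalar_prod_def sum_distrib_left mult.assoc)
    hence "((complex_of_real c \<cdot>\<^sub>m A) *\<^sub>v v) \<bullet>c v = complex_of_real c * ((A *\<^sub>v v) \<bullet>c v)"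
      using a(1) v by (simp add: smult_scalar_prod_distrib[of _ d])
    thus ?thesis using assms v by (simp add: psd_mat_def)
  qed
  moreover have "hermitian_mat (complex_of_real c \<cdot>\<^sub>m A)"
    unfolding hermitian_mat_def
    using a(1) hermitian_mat_index[OF a(2,1), symmetric] by (intro eq_matI) auto
  ultimately show ?thesis using a(1) by (simp add: psd_mat_def)
qed

lemma spectral_decomp_smult:
  assumes "spectral_decomp d A U l"
  shows "spectral_decomp d (complex_of_real c \<cdot>\<^sub>m A) U (\<lambda>i. c * l i)"
proof -
  note s = spectral_decompD[OF assms] and u = unitary_matD[OF spectral_decompD(1)[OF assms]]
  have "real_diag d (\<lambda>i. c * l i) = complex_of_real c \<cdot>\<^sub>m real_diag d l"
    by (intro eq_matI) auto
  hence "U * real_diag d (\<lambda>i. c * l i) * mat_adjoint U = complex_of_real c \<cdot>\<^sub>m (U * real_diag d l * mat_adjoint U)"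
    using u(1,2) by (simp add: mult_smult_distrib[of _ d d _ d] mult_smult_assoc_mat[of _ d d _ d] mult_carrier)
  thus ?thesis using s(1,2) by (simp add: spectral_decomp_def)
qed

lemma density_matsD:
  assumes "\<rho> \<in> density_mats d"
  shows "psd_mat d \<rho>" "\<rho> \<in> carrier_mat d d" "mat_trace \<rho> = 1"
  using assms psd_matD by (auto simp: density_mats_def)

text \<open>The term c ln c is spread over the eigenvalues, which sum to 1. If \<open>c\<close> or
  an eigenvalue is 0, the splitting of the logarithm fails, but both sides vanish.\<close>

lemma vN_entropy_smult:
  assumes "\<rho> \<in> density_mats d" "0 \<le> c"
  shows "vN_entropy (complex_of_real c \<cdot>\<^sub>m \<rho>) = c * vN_entropy \<rho> - c * ln c"
proof -
  note r = density_matsD[OF assms(1)]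
  obtain U l where s: "spectral_decomp d \<rho> U l"
    using spectral_decomp_exists[OF psd_matD[OF r(1)]] .
  have l: "(\<Sum>i<d. l i) = 1" using spectral_trace[OF s] r(3) by simp
  have "(\<Sum>i<d. c * l i * ln (c * l i)) = (\<Sum>i<d. c * (l i * ln (l i)) + c * ln c * l i)"
  proof (rule sum.cong[OF refl])
    fix i assume "i \<in> {..<d}"
    hence "0 \<le> l i" using spectral_psd_nonneg[OF s r(1)] by simp
    thus "c * l i * ln (c * l i) = c * (l i * ln (l i)) + c * ln c * l i"
      using assms(2) by (cases "c = 0 \<or> l i = 0") (auto simp: ln_mult algebra_simps)
  qed
  also have "\<dots> = c * (\<Sum>i<d. l i * ln (l i)) + c * ln c"
    by (simp only: sum.distrib sum_distrib_left[symmetric] l mult_1_right)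
  finally show ?thesis
    by (simp add: vN_entropy_eq[OF s] vN_entropy_eq[OF spectral_decomp_smult[OF s]])
qed

lemma add_minus_cancel_mat:
  fixes A B :: "complex mat"
  assumes "A \<in> carrier_mat d d" "B \<in> carrier_mat d d"
  shows "A + B - A = B" "A + B - B = A"
  using assms by (auto intro!: eq_matI)

text \<open>Each summand is dominated by the sum, so each satisfies the logarithmic trace inequality
  in the same eigenbasis of \<open>A + B\<close>; the two right sides add up to minus the entropy of
  the sum. No normalisation of the summands enters.\<close>

lemma vN_entropy_subadditive:
  assumes "psd_mat d A" "psd_mat d B"
  shows "vN_entropy (A + B) \<le> vN_entropy A + vN_entropy B"
proof -
  note a = psd_matD[OF assms(1)] and b = psd_matD[OF assms(2)] and w = psd_mat_add[OF assms]
  obtain U p where A: "spectral_decomp d A U p" using spectral_decomp_exists[OF a] .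
  obtain U' p' where B: "spectral_decomp d B U' p'" using spectral_decomp_exists[OF b] .
  obtain V q where W: "spectral_decomp d (A + B) V q" using spectral_decomp_exists[OF psd_matD[OF w]] .
  have "- vN_entropy A \<le> cross_ln d A V q"
    using assms add_minus_cancel_mat[OF a(1) b(1)]
    by (intro entropy_le_cross_of_dominated[OF A assms(1) W _ w]) simp
  moreover have "- vN_entropy B \<le> cross_ln d B V q"
    using assms add_minus_cancel_mat[OF a(1) b(1)]
    by (intro entropy_le_cross_of_dominated[OF B assms(2) W _ w]) simp
  moreover have "cross_ln d A V q + cross_ln d B V q = - vN_entropy (A + B)"
    using cross_ln_add[OF a(1) b(1) unitary_matD(1)[OF spectral_decompD(1)[OF W]]] cross_ln_self[OF W] by simp
  ultimately show ?thesis by simp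
qed

text \<open>A Holevo-type bound: the entropy gained by mixing is at least the information about the summands
  accessible to the measurement \<open>{Q, 1 - Q}\<close>.\<close>

lemma vN_entropy_add_ge_measured:
  assumes "psd_mat d A" "psd_mat d B" and Q: "projection_mat d Q"
  defines "a1 \<equiv> Re (mat_trace (A * Q))" and "a2 \<equiv> Re (mat_trace A - mat_trace (A * Q))"
    and "b1 \<equiv> Re (mat_trace (B * Q))" and "b2 \<equiv> Re (mat_trace B - mat_trace (B * Q))"
  shows "vN_entropy A + vN_entropy B
      + (a1 * ln a1 + b1 * ln b1 - (a1 + b1) * ln (a1 + b1))
      + (a2 * ln a2 + b2 * ln b2 - (a2 + b2) * ln (a2 + b2))
    \<le> vN_entropy (A + B)"
proof -
  note a = psd_matD[OF assms(1)] and b = psd_matD[OF assms(2)] and w = psd_mat_add[OF assms(1,2)]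
  note Qc = projection_matD(1)[OF Q]
  obtain U p where A: "spectral_decomp d A U p" using spectral_decomp_exists[OF a] .
  obtain U' p' where B: "spectral_decomp d B U' p'" using spectral_decomp_exists[OF b] .
  obtain V q where W: "spectral_decomp d (A + B) V q" using spectral_decomp_exists[OF psd_matD[OF w]] .
  have 1: "Re (mat_trace ((A + B) * Q)) = a1 + b1"
    using a(1) b(1) Qc by (simp add: a1_def b1_def add_mult_distrib_mat[of _ d d _ _ d] mat_trace_add[of _ d] mult_carrier)
  hence 2: "Re (mat_trace (A + B) - mat_trace ((A + B) * Q)) = a2 + b2"
    using a(1) b(1) by (simp add: a1_def b1_def a2_def b2_def mat_trace_add[of _ d])
  have leA: "psd_mat d (A + B - A)" and leB: "psd_mat d (A + B - B)"
    using assms(1,2) add_minus_cancel_mat[OF a(1) b(1)] by simp_all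
  have "(a1 * ln a1 - a1 * ln (a1 + b1)) + (a2 * ln a2 - a2 * ln (a2 + b2)) \<le> - vN_entropy A - cross_ln d A V q"
    using relative_entropy_ge_measured[OF A assms(1) W w leA Q] unfolding 1 2 a1_def a2_def .
  moreover have "(b1 * ln b1 - b1 * ln (a1 + b1)) + (b2 * ln b2 - b2 * ln (a2 + b2)) \<le> - vN_entropy B - cross_ln d B V q"
    using relative_entropy_ge_measured[OF B assms(2) W w leB Q] unfolding 1 2 b1_def b2_def .
  moreover have "cross_ln d A V q + cross_ln d B V q = - vN_entropy (A + B)"
    using cross_ln_add[OF a(1) b(1) unitary_matD(1)[OF spectral_decompD(1)[OF W]]] cross_ln_self[OF W] by simp
  ultimately show ?thesis by (simp add: algebra_simps)
qed

text \<open>Multiplying A w = 0 by \<open>mat_adjoint U\<close> gives l_i <u_i, w> = 0 for each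
  coordinate of w, and l_i is nonzero.\<close>

lemma eigenvector_in_support:
  assumes "spectral_decomp d A U l" "i < d" "l i \<noteq> 0"
  shows "col U i \<in> mat_support A"
proof -
  note s = spectral_decompD[OF assms(1)] and u = unitary_matD[OF spectral_decompD(1)[OF assms(1)]]
  have "col U i \<bullet>c w = 0" if "w \<in> mat_kernel A" for w
  proof -
    have w: "w \<in> carrier_vec d" "A *\<^sub>v w = 0\<^sub>v d"
      using that s(3) by (auto simp: mat_kernel_def)
    define y where "y = mat_adjoint U *\<^sub>v w"
    have y: "y \<in> carrier_vec d" using u w by (simp add: y_def)
    have "mat_adjoint U * A = real_diag d l * mat_adjoint U"
    proof -
      have "mat_adjoint U * A = mat_adjoint U * (U * (real_diag d l * mat_adjoint U))"
        using u(1,2) by (simp add: s(2) assoc_mult_mat[of _ d d _ d _ d] mult_carrier)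
      also have "\<dots> = (mat_adjoint U * U) * (real_diag d l * mat_adjoint U)"
        by (rule assoc_mult_mat[OF u(2,1) mult_carrier[OF real_diag_carrier u(2)], symmetric])
      finally show ?thesis using u by (simp add: left_mult_one_mat[OF mult_carrier[OF real_diag_carrier u(2)]])
    qed
    hence "real_diag d l *\<^sub>v y = mat_adjoint U *\<^sub>v (A *\<^sub>v w)"
      using u(1,2) s(3) w(1) unfolding y_def
      by (simp add: assoc_mult_mat_vec[of _ d d _ d, symmetric])
    hence "(real_diag d l *\<^sub>v y) $ i = 0" using u(1) w(2) assms(2) by (simp add: scalar_prod_def)
    moreover have "(real_diag d l *\<^sub>v y) $ i = complex_of_real (l i) * y $ i"
    proof -
      have "(real_diag d l *\<^sub>v y) $ i = (\<Sum>k<d. (if i = k then complex_of_real (l k) else 0) * y $ k)"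
        using y assms(2) by (simp add: scalar_prod_def atLeast0LessThan)
      also have "\<dots> = (\<Sum>k<d. if i = k then complex_of_real (l k) * y $ k else 0)"
        by (intro sum.cong) auto
      finally show ?thesis using assms(2) by simp
    qed
    ultimately have "y $ i = 0" using assms(3) by simp
    moreover have "col U i \<bullet>c w = cnj (y $ i)"
      using u(1) w(1) assms(2) by (simp add: y_def scalar_prod_def)
    ultimately show ?thesis by simp
  qed
  thus ?thesis using u(1) s(3) by (auto simp: mat_support_def intro!: carrier_vecI)
qed

text \<open>Take for \<open>Q\<close> the projection onto the eigenvectors of \<open>\<rho>\<close>
  with nonzero eigenvalue. It retains all of the trace of \<open>\<rho>\<close>, while the overlaps
  with eigenvectors of \<open>\<sigma>\<close> of nonzero eigenvalue vanish, as both families lie in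
  the supports.\<close>

lemma support_projection:
  assumes r: "\<rho> \<in> density_mats d" and s: "\<sigma> \<in> density_mats d" and orth: "orthogonal_supports \<rho> \<sigma>"
  obtains Q where "projection_mat d Q" "Re (mat_trace (\<rho> * Q)) = 1" "Re (mat_trace (\<sigma> * Q)) = 0"
proof -
  note rp = density_matsD[OF r] and sp = density_matsD[OF s]
  obtain U l where R: "spectral_decomp d \<rho> U l" using spectral_decomp_exists[OF psd_matD[OF rp(1)]] .
  obtain V m where S: "spectral_decomp d \<sigma> V m" using spectral_decomp_exists[OF psd_matD[OF sp(1)]] .
  note u = unitary_matD[OF spectral_decompD(1)[OF R]] and v = unitary_matD[OF spectral_decompD(1)[OF S]]
  define e where "e i = (if l i \<noteq> 0 then 1 else 0 :: real)" for i
  define Q where "Q = U * real_diag d e * mat_adjoint U"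
  have Q: "spectral_decomp d Q U e"
    using spectral_decompD(1)[OF R] by (simp add: spectral_decomp_def Q_def)
  note Qc = spectral_decompD(3)[OF Q]
  have "hermitian_mat Q"
    using hermitian_sandwich[of "real_diag d e" d "mat_adjoint U" d] u(2) by (simp add: Q_def hermitian_mat_def)
  moreover have "Q * Q = Q"
  proof -
    have ee: "real_diag d e * real_diag d e = real_diag d e"
      unfolding real_diag_def mat_diag_diag by (intro arg_cong[of _ _ "mat_diag d"] ext) (simp add: e_def)
    have "Q * Q = U * real_diag d e * (mat_adjoint U * Q)"
      unfolding Q_def using u(1,2) by (simp add: assoc_mult_mat[of _ d d _ d _ d] mult_carrier)
    also have "mat_adjoint U * Q = mat_adjoint U * U * (real_diag d e * mat_adjoint U)"
      unfolding Q_def using u(1,2) by (simp add: assoc_mult_mat[of _ d d _ d _ d] mult_carrier)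
    also have "\<dots> = real_diag d e * mat_adjoint U"
      using u by (simp add: left_mult_one_mat[OF mult_carrier[OF real_diag_carrier u(2)]])
    also have "U * real_diag d e * \<dots> = U * (real_diag d e * real_diag d e) * mat_adjoint U"
      using u(1,2) by (simp add: assoc_mult_mat[of _ d d _ d _ d] mult_carrier del: mat_diag_diag)
    finally show ?thesis by (simp add: ee Q_def)
  qed
  ultimately have P: "projection_mat d Q" using Qc by (simp add: projection_mat_def)
  have "Re (mat_trace (\<rho> * Q)) = (\<Sum>i<d. l i)"
    unfolding spectral_trace_mult[OF R Qc] spectral_decomp_diag[OF Q]
    by (intro sum.cong) (auto simp: e_def)
  hence 1: "Re (mat_trace (\<rho> * Q)) = 1" using spectral_trace[OF R] rp(3) by simp
  have "Re (mat_trace (\<sigma> * Q)) = Re (mat_trace (Q * \<sigma>))"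
    using mat_trace_mult_comm[OF Qc sp(2)] by simp
  also have "\<dots> = (\<Sum>i<d. e i * (\<Sum>k<d. m k * (cmod ((mat_adjoint V * U) $$ (k, i)))\<^sup>2))"
    unfolding spectral_trace_mult[OF Q sp(2)]
    by (intro sum.cong refl) (simp add: spectral_sandwich_index[OF S u(1)] del: index_mult_mat(1))
  also have "\<dots> = 0"
  proof (rule sum.neutral, rule ballI)
    fix i assume "i \<in> {..<d}"
    hence i: "i < d" by simp
    have "m k * (cmod ((mat_adjoint V * U) $$ (k, i)))\<^sup>2 = 0" if "l i \<noteq> 0" "k < d" for k
    proof (cases "m k = 0")
      case False
      have "col U i \<bullet>c col V k = 0"
        using orth eigenvector_in_support[OF R i that(1)] eigenvector_in_support[OF S that(2) False]
        by (simp add: orthogonal_supports_def)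
      moreover have "(mat_adjoint V * U) $$ (k, i) = col U i \<bullet>c col V k"
        using u(1) v(1) i that(2) by (auto simp: scalar_prod_def intro!: sum.cong)
      ultimately show ?thesis by simp
    qed simp
    thus "e i * (\<Sum>k<d. m k * (cmod ((mat_adjoint V * U) $$ (k, i)))\<^sup>2) = 0"
      by (auto simp: e_def simp del: index_mult_mat(1) intro!: sum.neutral)
  qed
  finally show ?thesis using that[OF P 1] by simp
qed

text \<open>For s > 0 the left side is s h(\<open>\<epsilon>\<close>/s), which increases with s.
  Instead of differentiating, the proof compares directly with the value at s = 1; the cases
  \<open>\<epsilon>\<close> = 0 and s = \<open>\<epsilon>\<close> are split off to keep the
  logarithms and the denominator s - \<open>\<epsilon>\<close> regular.\<close>

lemma entropy_split_le_binary_entropy: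
  fixes \<epsilon> s :: real
  assumes "0 \<le> \<epsilon>" "\<epsilon> \<le> s" "s \<le> 1"
  shows "s * ln s - \<epsilon> * ln \<epsilon> - (s - \<epsilon>) * ln (s - \<epsilon>) \<le> binary_entropy \<epsilon>"
proof -
  consider "\<epsilon> = 0" | "0 < \<epsilon>" "s = \<epsilon>" | "0 < \<epsilon>" "\<epsilon> < s" using assms by linarith
  thus ?thesis
  proof cases
    case 1
    thus ?thesis by (simp add: binary_entropy_def)
  next
    case 2
    have "\<epsilon> * ln \<epsilon> \<le> 0" using 2 assms by (intro mult_nonneg_nonpos) auto
    moreover have "(1 - \<epsilon>) * ln (1 - \<epsilon>) \<le> 0"
      using 2 assms by (cases "\<epsilon> = 1") (auto intro!: mult_nonneg_nonpos)
    ultimately show ?thesis using 2 by (simp add: binary_entropy_def)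
  next
    case 3
    hence "\<epsilon> < 1" "0 < s" using assms by auto
    \<comment> \<open>The left side minus the right side is a sum of three terms. Two of them are
      bounded by ln t \<le> t - 1, with bounds that cancel each other, and the third is (1 - s) ln
      (1 - \<open>\<epsilon>\<close>) \<le> 0.\<close>
    have "\<epsilon> * ln s \<le> \<epsilon> * (s - 1)" using 3 \<open>0 < s\<close> by (intro mult_left_mono ln_le_minus_one) auto
    moreover have "(s - \<epsilon>) * (ln s + ln (1 - \<epsilon>) - ln (s - \<epsilon>)) \<le> \<epsilon> * (1 - s)"
    proof -
      have "ln s + ln (1 - \<epsilon>) - ln (s - \<epsilon>) = ln (s * (1 - \<epsilon>) / (s - \<epsilon>))"
        using 3 \<open>\<epsilon> < 1\<close> \<open>0 < s\<close> by (simp add: ln_div ln_mult)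
      also have "\<dots> \<le> s * (1 - \<epsilon>) / (s - \<epsilon>) - 1"
        using 3 \<open>\<epsilon> < 1\<close> \<open>0 < s\<close> by (intro ln_le_minus_one) auto
      also have "\<dots> = \<epsilon> * (1 - s) / (s - \<epsilon>)"
        using 3 by (simp add: field_simps)
      finally show ?thesis using 3 by (simp add: pos_le_divide_eq mult.commute)
    qed
    moreover have "(1 - s) * ln (1 - \<epsilon>) \<le> 0"
      using 3 \<open>\<epsilon> < 1\<close> assms by (intro mult_nonneg_nonpos) auto
    ultimately show ?thesis by (simp add: binary_entropy_def algebra_simps)
  qed
qed

lemma entropy_difference_bound:
  assumes \<epsilon>: "0 \<le> \<epsilon>" and \<rho>1: "\<rho>1 \<in> density_mats d" and \<rho>2: "\<rho>2 \<in> density_mats d"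
    and jh: "normalized_jordan_hahn d \<epsilon> \<rho>1 \<rho>2 \<rho>p \<rho>m"
  shows "vN_entropy \<rho>1 - vN_entropy \<rho>2 \<le> \<epsilon> * vN_entropy \<rho>p - \<epsilon> * vN_entropy \<rho>m + binary_entropy \<epsilon>"
proof -
  have \<rho>p: "\<rho>p \<in> density_mats d" and \<rho>m: "\<rho>m \<in> density_mats d" and orth: "orthogonal_supports \<rho>p \<rho>m"
    and diff: "\<rho>1 - \<rho>2 = complex_of_real \<epsilon> \<cdot>\<^sub>m \<rho>p - complex_of_real \<epsilon> \<cdot>\<^sub>m \<rho>m"
    using jh by (auto simp: normalized_jordan_hahn_def)
  note r1 = density_matsD[OF \<rho>1] and r2 = density_matsD[OF \<rho>2]
    and rp = density_matsD[OF \<rho>p] and rm = density_matsD[OF \<rho>m]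
  define P where "P = complex_of_real \<epsilon> \<cdot>\<^sub>m \<rho>p"
  define N where "N = complex_of_real \<epsilon> \<cdot>\<^sub>m \<rho>m"
  have P: "psd_mat d P" "P \<in> carrier_mat d d" and N: "psd_mat d N" "N \<in> carrier_mat d d"
    using psd_mat_smult[OF rp(1) \<epsilon>] psd_mat_smult[OF rm(1) \<epsilon>] rp(2) rm(2) by (auto simp: P_def N_def)
  have eq: "\<rho>2 + P = \<rho>1 + N"
  proof (rule eq_matI)
    fix i j assume "i < dim_row (\<rho>1 + N)" "j < dim_col (\<rho>1 + N)"
    hence ij: "i < d" "j < d" using N by auto
    have "(\<rho>1 - \<rho>2) $$ (i, j) = (P - N) $$ (i, j)" using diff by (simp add: P_def N_def)
    hence "\<rho>1 $$ (i, j) - \<rho>2 $$ (i, j) = P $$ (i, j) - N $$ (i, j)"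
      using ij r1(2) r2(2) P(2) N(2) by simp
    thus "(\<rho>2 + P) $$ (i, j) = (\<rho>1 + N) $$ (i, j)"
      using ij r1(2) r2(2) P(2) N(2) by (simp add: algebra_simps)
  qed (use P N r1 r2 in auto)
  obtain Q where Q: "projection_mat d Q" and Qp: "Re (mat_trace (\<rho>p * Q)) = 1" and Qm: "Re (mat_trace (\<rho>m * Q)) = 0"
    using support_projection[OF \<rho>p \<rho>m orth] .
  note Qc = projection_matD(1)[OF Q]
  \<comment> \<open>Outcome Q has weight \<open>a\<close> under \<open>\<rho>2\<close>, hence a +
    \<open>\<epsilon>\<close> under \<open>\<rho>1\<close>, because N contributes nothing to it. As
    both weights lie in [0, 1], s = 1 - a ranges over [\<open>\<epsilon>\<close>, 1].\<close>
  define a where "a = Re (mat_trace (\<rho>2 * Q))"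
  have trP: "Re (mat_trace (P * Q)) = \<epsilon>" and trN: "Re (mat_trace (N * Q)) = 0" "Re (mat_trace N) = \<epsilon>"
    using rp(2) rm(2,3) Qc Qp Qm
    by (simp_all add: P_def N_def mult_smult_assoc_mat[of _ d d _ d] mat_trace_smult[of _ d] mult_carrier)
  have "Re (mat_trace (\<rho>1 * Q)) + Re (mat_trace (N * Q)) = a + Re (mat_trace (P * Q))"
    using arg_cong[OF eq, of "\<lambda>M. Re (mat_trace (M * Q))"] r1(2) r2(2) P(2) N(2) Qc
    by (simp add: a_def add_mult_distrib_mat[of _ d d _ _ d] mat_trace_add[of _ d] mult_carrier)
  hence tr1: "Re (mat_trace (\<rho>1 * Q)) = a + \<epsilon>" by (simp add: trP trN)
  have "0 \<le> a" using psd_trace_projection_nonneg[OF r2(1) Q] by (simp add: a_def)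
  moreover have "a + \<epsilon> \<le> 1"
    using psd_trace_projection_nonneg[OF r1(1) projection_mat_compl[OF Q]] r1(2,3) Qc
    by (simp add: trace_mult_compl tr1)
  ultimately have "(1 - a) * ln (1 - a) - \<epsilon> * ln \<epsilon> - (1 - a - \<epsilon>) * ln (1 - a - \<epsilon>) \<le> binary_entropy \<epsilon>"
    using \<epsilon> by (intro entropy_split_le_binary_entropy) auto
  \<comment> \<open>For outcome Q the weight of N is 0 and the classical term vanishes, so only the
    term of 1 - Q remains.\<close>
  moreover have "vN_entropy \<rho>1 + vN_entropy N
      + ((1 - a - \<epsilon>) * ln (1 - a - \<epsilon>) + \<epsilon> * ln \<epsilon> - (1 - a) * ln (1 - a)) \<le> vN_entropy (\<rho>1 + N)"
    using vN_entropy_add_ge_measured[OF r1(1) N(1) Q] by (simp add: tr1 trN r1(3) algebra_simps)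
  moreover have "vN_entropy (\<rho>1 + N) \<le> vN_entropy \<rho>2 + vN_entropy P"
    using vN_entropy_subadditive[OF r2(1) P(1)] by (simp add: eq)
  \<comment> \<open>The corrections - \<open>\<epsilon>\<close> ln \<open>\<epsilon>\<close> agree
    for P and N, so they cancel in the difference of the two entropies.\<close>
  moreover have "vN_entropy P = \<epsilon> * vN_entropy \<rho>p - \<epsilon> * ln \<epsilon>" "vN_entropy N = \<epsilon> * vN_entropy \<rho>m - \<epsilon> * ln \<epsilon>"
    unfolding P_def N_def using vN_entropy_smult \<rho>p \<rho>m \<epsilon> by auto
  ultimately show ?thesis by linarith
qed

section \<open>Tightness from diagonal states\<close>

lemma spectral_decomp_real_diag: "spectral_decomp d (real_diag d l) (1\<^sub>m d) l"
  by (auto simp: spectral_decomp_def unitary_mat_def right_mult_one_mat[of _ d d] left_mult_one_mat[of _ d d])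

lemma real_diag_density:
  assumes "\<And>i. i < d \<Longrightarrow> 0 \<le> l i" "(\<Sum>i<d. l i) = 1"
  shows "real_diag d l \<in> density_mats d"
proof -
  have "0 \<le> Re ((real_diag d l *\<^sub>v v) \<bullet>c v)" if v: "v \<in> carrier_vec d" for v
  proof -
    have "(real_diag d l *\<^sub>v v) $ i = complex_of_real (l i) * v $ i" if "i < d" for i
    proof -
      have "(real_diag d l *\<^sub>v v) $ i = (\<Sum>k<d. (if i = k then complex_of_real (l k) else 0) * v $ k)"
        using v that by (simp add: scalar_prod_def atLeast0LessThan)
      also have "\<dots> = (\<Sum>k<d. if i = k then complex_of_real (l k) * v $ k else 0)"
        by (intro sum.cong) auto
      finally show ?thesis using that by simp
    qed
    hence "(real_diag d l *\<^sub>v v) \<bullet>c v = (\<Sum>i<d. complex_of_real (l i) * (v $ i * cnj (v $ i)))"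
      using v by (auto simp: scalar_prod_def[of _ "conjugate v"] atLeast0LessThan mult.assoc intro!: sum.cong)
    also have "\<dots> = complex_of_real (\<Sum>i<d. l i * (cmod (v $ i))\<^sup>2)"
      by (simp add: complex_norm_square del: of_real_power)
    finally show ?thesis using assms(1) by (auto simp del: of_real_sum intro!: sum_nonneg)
  qed
  moreover have "mat_trace (real_diag d l) = complex_of_real (\<Sum>i<d. l i)"
    by (simp add: mat_trace_def)
  ultimately show ?thesis
    using assms(2) by (simp add: density_mats_def psd_mat_def hermitian_mat_def)
qed

lemma trace_norm_real_diag: "trace_norm (real_diag d l) = (\<Sum>i<d. \<bar>l i\<bar>)"
proof -
  have "real_diag d l * real_diag d l = real_diag d (\<lambda>i. (l i)\<^sup>2)"
    by (simp add: real_diag_def power2_eq_square)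
  hence "mat_fun sqrt (mat_adjoint (real_diag d l) * real_diag d l) = real_diag d (\<lambda>i. \<bar>l i\<bar>)"
    using mat_fun_eq[OF spectral_decomp_real_diag, of sqrt d "\<lambda>i. (l i)\<^sup>2"]
    by (simp add: right_mult_one_mat[of _ d d] left_mult_one_mat[of _ d d])
  thus ?thesis by (simp add: trace_norm_def mat_trace_def)
qed

lemma mat_support_real_diag:
  assumes "v \<in> mat_support (real_diag d l)" "i < d" "l i = 0"
  shows "v $ i = 0"
proof -
  have v: "v \<in> carrier_vec d" using assms(1) by (simp add: mat_support_def)
  have "real_diag d l *\<^sub>v unit_vec d i = 0\<^sub>v d"
    using assms(2,3) by (intro eq_vecI) auto
  hence "unit_vec d i \<in> mat_kernel (real_diag d l)" by (simp add: mat_kernel_def)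
  hence "v \<bullet>c unit_vec d i = 0" using assms(1) by (simp add: mat_support_def)
  moreover have "conjugate (unit_vec d i) = (unit_vec d i :: complex vec)"
    by (intro eq_vecI) (auto simp: unit_vec_def)
  ultimately show ?thesis using v assms(2) by simp
qed

lemma orthogonal_supports_real_diag:
  assumes "\<And>i. i < d \<Longrightarrow> k i = 0 \<or> l i = 0"
  shows "orthogonal_supports (real_diag d k) (real_diag d l)"
  unfolding orthogonal_supports_def
proof (intro ballI)
  fix v w assume vw: "v \<in> mat_support (real_diag d k)" "w \<in> mat_support (real_diag d l)"
  have "w \<in> carrier_vec d" using vw by (simp add: mat_support_def)
  moreover have "v $ i * cnj (w $ i) = 0" if "i < d" for i
    using assms[OF that] mat_support_real_diag[OF vw(1) that] mat_support_real_diag[OF vw(2) that] by auto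
  ultimately show "v \<bullet>c w = 0"
    by (auto simp: scalar_prod_def intro!: sum.neutral)
qed

lemma entropy_difference_tight:
  fixes \<epsilon> :: real
  assumes "2 \<le> d" "0 \<le> \<epsilon>" "\<epsilon> \<le> 1"
  shows "\<exists>\<rho>1 \<rho>2 \<rho>p \<rho>m. \<rho>1 \<in> density_mats d \<and> \<rho>2 \<in> density_mats d \<and>
    1 / 2 * trace_norm (\<rho>1 - \<rho>2) = \<epsilon> \<and> normalized_jordan_hahn d \<epsilon> \<rho>1 \<rho>2 \<rho>p \<rho>m \<and>
    vN_entropy \<rho>1 - vN_entropy \<rho>2 = \<epsilon> * vN_entropy \<rho>p - \<epsilon> * vN_entropy \<rho>m + binary_entropy \<epsilon>"
proof -
  define D where "D x y = real_diag d (\<lambda>i. if i = 0 then x else if i = 1 then y else 0)" for x y :: real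
  obtain n where n: "d = Suc (Suc n)" using assms(1) by (metis Suc_le_D numeral_2_eq_2 Suc_le_mono)
  \<comment> \<open>The other d - 2 diagonal entries contribute \<open>f 0\<close>, which is 0 for
    all three functions used: t, |t| and t ln t, the last by convention.\<close>
  have sum: "(\<Sum>i<d. f (if i = 0 then x else if i = 1 then y else 0)) = f x + f y"
    if "f 0 = 0" for f :: "real \<Rightarrow> real" and x y
    using that unfolding n by (simp add: sum.lessThan_Suc_shift del: sum.lessThan_Suc)
  have dens: "D x y \<in> density_mats d" if "0 \<le> x" "0 \<le> y" "x + y = 1" for x y
    unfolding D_def using that sum[of "\<lambda>t. t" x y] by (intro real_diag_density) auto
  have ent: "vN_entropy (D x y) = - (x * ln x + y * ln y)" for x y
    unfolding D_def vN_entropy_eq[OF spectral_decomp_real_diag] using sum[of "\<lambda>t. t * ln t" x y] by simp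
  have diff: "D x y - D x' y' = D (x - x') (y - y')" for x y x' y'
    unfolding D_def by (intro eq_matI) auto
  have smult: "complex_of_real c \<cdot>\<^sub>m D x y = D (c * x) (c * y)" for c x y
    unfolding D_def by (intro eq_matI) auto
  have tn: "trace_norm (D x y) = \<bar>x\<bar> + \<bar>y\<bar>" for x y
    unfolding D_def trace_norm_real_diag using sum[of abs x y] by simp
  have orth: "orthogonal_supports (D 0 1) (D 1 0)"
    unfolding D_def by (intro orthogonal_supports_real_diag) auto
  show ?thesis
    \<comment> \<open>Apart from \<open>\<rho>1\<close> all four states are pure, so both sides
      reduce to the entropy of diag(1 - \<open>\<epsilon>\<close>, \<open>\<epsilon>\<close>, 0,
      ...). The choice of \<open>\<rho>p\<close> and \<open>\<rho>m\<close> does not depend on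
      \<open>\<epsilon>\<close> and so also serves at \<open>\<epsilon>\<close> = 0.\<close>
    using assms dens orth
    by (intro exI[of _ "D (1 - \<epsilon>) \<epsilon>"] exI[of _ "D 1 0"] exI[of _ "D 0 1"] exI[of _ "D 1 0"])
      (simp add: diff smult tn ent normalized_jordan_hahn_def binary_entropy_def)
qed

theorem theorem1:
  fixes d :: nat
  assumes "d \<ge> 2"
  shows "(\<forall>\<epsilon>::real. \<forall>\<rho>1 \<rho>2 \<rho>p \<rho>m :: complex mat.
            0 \<le> \<epsilon> \<longrightarrow> \<epsilon> \<le> 1 \<longrightarrow>
            \<rho>1 \<in> density_mats d \<longrightarrow> \<rho>2 \<in> density_mats d \<longrightarrow>
            1 / 2 * trace_norm (\<rho>1 - \<rho>2) = \<epsilon> \<longrightarrow>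
            normalized_jordan_hahn d \<epsilon> \<rho>1 \<rho>2 \<rho>p \<rho>m \<longrightarrow>
            vN_entropy \<rho>1 - vN_entropy \<rho>2
              \<le> \<epsilon> * vN_entropy \<rho>p - \<epsilon> * vN_entropy \<rho>m + binary_entropy \<epsilon>) \<and>
         (\<forall>\<epsilon>::real. 0 \<le> \<epsilon> \<longrightarrow> \<epsilon> \<le> 1 \<longrightarrow>
            (\<exists>\<rho>1 \<rho>2 \<rho>p \<rho>m :: complex mat.
              \<rho>1 \<in> density_mats d \<and> \<rho>2 \<in> density_mats d \<and>
              1 / 2 * trace_norm (\<rho>1 - \<rho>2) = \<epsilon> \<and>
              normalized_jordan_hahn d \<epsilon> \<rho>1 \<rho>2 \<rho>p \<rho>m \<and>
              vN_entropy \<rho>1 - vN_entropy \<rho>2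
                = \<epsilon> * vN_entropy \<rho>p - \<epsilon> * vN_entropy \<rho>m + binary_entropy \<epsilon>))"
  using entropy_difference_bound entropy_difference_tight[OF assms] by blast

end
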